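(* Let $H$ be an infinite dimensional complex Hilbert space and let $T\in\mathcal B(H)$. Then the following statements are equivalent: (1) $T$ is positive and $T\in\mathcal{AN}(H)$; (2) there exists a unique triple $(K,F,\alpha)$, where (a) $K\in\mathcal K(H)$ is positive, (b) $F\in\mathcal F(H)$ and $0\le F\le \alpha I$ (with $\alpha\geq 0$ a real number), and (c) $KF=0$, such that $T=K-F+\alpha I$.
   Context: $\mathcal B(H)$, $\mathcal K(H)$, $\mathcal F(H)$ denote the bounded, compact, and finite rank linear operators on $H$. An operator $T\in\mathcal B(H)$ is positive if it is self-adjoint and $\langle Tx,x\rangle\ge 0$ for all $x\in H$; for self-adjoint $S,T$, $S\le T$ means $T-S$ is positive. An operator $T\in\mathcal B(H_1,H_2)$ is norm attaining if there is $x\in H_1$ with $\|x\|=1$ and $\|Tx\|=\|T\|$. It is absolutely norm attaining (an $\mathcal{AN}$-operator, written $T\in\mathcal{AN}(H_1,H_2)$, and $\mathcal{AN}(H)$ if $H_1=H_2=H$) if the restriction $T|_M:M\to H_2$ is norm attaining for every nonzero closed subspace $M$ of $H_1$. *)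

theory Defs
  imports "HOL-Analysis.Analysis"
begin

(* The inner product is linear in the first argument. By norm_eq_sqrt_inner, the axiom
   inner_eq_Re_cinner makes the norm (and hence the topology) the one induced by cinner. *)
class complex_hilbert = real_inner + complete_space +
  fixes scaleC :: "complex \<Rightarrow> 'a \<Rightarrow> 'a"  (infixr "*\<^sub>C" 75)
    and cinner :: "'a \<Rightarrow> 'a \<Rightarrow> complex"
  assumes scaleC_add_right: "a *\<^sub>C (x + y) = a *\<^sub>C x + a *\<^sub>C y"
    and scaleC_add_left: "(a + b) *\<^sub>C x = a *\<^sub>C x + b *\<^sub>C x"
    and scaleC_scaleC: "a *\<^sub>C b *\<^sub>C x = (a * b) *\<^sub>C x"
    and scaleC_one: "1 *\<^sub>C x = x"
    and scaleR_eq_scaleC: "r *\<^sub>R x = complex_of_real r *\<^sub>C x"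
    and cinner_commute: "cinner x y = cnj (cinner y x)"
    and cinner_add_left: "cinner (x + y) z = cinner x z + cinner y z"
    and cinner_scaleC_left: "cinner (a *\<^sub>C x) y = a * cinner x y"
    and inner_eq_Re_cinner: "x \<bullet> y = Re (cinner x y)"
begin

subclass banach ..

end

global_interpretation complex_vector: vector_space "scaleC :: complex \<Rightarrow> 'a \<Rightarrow> 'a::complex_hilbert"
  defines csubspace = complex_vector.subspace
    and cspan = complex_vector.span
  by unfold_locales
    (simp_all add: scaleC_add_right scaleC_add_left scaleC_scaleC scaleC_one)

definition cfinite_dim :: "'a::complex_hilbert set \<Rightarrow> bool" where
  "cfinite_dim S \<longleftrightarrow> (\<exists>B. finite B \<and> cspan B = S)"

definition bounded_clinear :: "('a::complex_hilbert \<Rightarrow> 'b::complex_hilbert) \<Rightarrow> bool" where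
  "bounded_clinear T \<longleftrightarrow> bounded_linear T \<and> (\<forall>c x. T (c *\<^sub>C x) = c *\<^sub>C T x)"

definition compact_op :: "('a::complex_hilbert \<Rightarrow> 'b::complex_hilbert) \<Rightarrow> bool" where
  "compact_op T \<longleftrightarrow> bounded_clinear T \<and> compact (closure (T ` cball 0 1))"

definition finite_rank_op :: "('a::complex_hilbert \<Rightarrow> 'b::complex_hilbert) \<Rightarrow> bool" where
  "finite_rank_op T \<longleftrightarrow> bounded_clinear T \<and> cfinite_dim (range T)"

definition is_cadjoint ::
  "('b::complex_hilbert \<Rightarrow> 'a::complex_hilbert) \<Rightarrow> ('a \<Rightarrow> 'b) \<Rightarrow> bool" where
  "is_cadjoint S T \<longleftrightarrow> (\<forall>x y. cinner (T x) y = cinner x (S y))"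

definition selfadjoint_op :: "('a::complex_hilbert \<Rightarrow> 'a) \<Rightarrow> bool" where
  "selfadjoint_op T \<longleftrightarrow> bounded_clinear T \<and> is_cadjoint T T"

definition positive_op :: "('a::complex_hilbert \<Rightarrow> 'a) \<Rightarrow> bool" where
  "positive_op T \<longleftrightarrow> selfadjoint_op T \<and> (\<forall>x. cinner (T x) x \<in> \<real>\<^sub>\<ge>\<^sub>0)"

definition le_op :: "('a::complex_hilbert \<Rightarrow> 'a) \<Rightarrow> ('a \<Rightarrow> 'a) \<Rightarrow> bool" where
  "le_op S T \<longleftrightarrow> selfadjoint_op S \<and> selfadjoint_op T \<and> positive_op (\<lambda>x. T x - S x)"

(* The operator norm of the restriction of T to M; for M = UNIV this is onorm T.
   A possible x = 0 contributes 0 / 0 = 0. *)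
definition onorm_on :: "'a::complex_hilbert set \<Rightarrow> ('a \<Rightarrow> 'b::complex_hilbert) \<Rightarrow> real" where
  "onorm_on M T = (SUP x\<in>M. norm (T x) / norm x)"

definition norm_attaining_on :: "'a::complex_hilbert set \<Rightarrow> ('a \<Rightarrow> 'b::complex_hilbert) \<Rightarrow> bool" where
  "norm_attaining_on M T \<longleftrightarrow> (\<exists>x\<in>M. norm x = 1 \<and> norm (T x) = onorm_on M T)"

definition abs_norm_attaining :: "('a::complex_hilbert \<Rightarrow> 'b::complex_hilbert) \<Rightarrow> bool" where
  "abs_norm_attaining T \<longleftrightarrow> bounded_clinear T \<and>
     (\<forall>M. csubspace M \<and> closed M \<and> M \<noteq> {0} \<longrightarrow> norm_attaining_on M T)"

end

theory Submission
  imports Defs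
begin

text \<open>For a positive \<open>\<A>\<N>\<close>-operator \<open>T\<close>, maximising \<open>\<parallel>T x\<parallel>\<close> successively on orthogonal complements gives
  orthonormal eigenvectors \<open>e n\<close> whose eigenvalues decrease to some \<open>\<alpha>\<close>. Then
  \<open>K = \<Sum>n. (\<lambda> n - \<alpha>) \<langle>\<cdot>, e n\<rangle> e n\<close> is compact and positive, \<open>F = K + \<alpha> - T\<close> satisfies \<open>0 \<le> F \<le> \<alpha>\<close> and
  \<open>K F = 0\<close>, and \<open>F\<close> has finite rank, since otherwise mixing eigenvectors for eigenvalues at least
  \<open>\<alpha>\<close> with eigenvectors for eigenvalues below \<open>\<alpha>\<close> produces a closed subspace on which \<open>T\<close> does not
  attain its norm. Conversely, for \<open>T = K - F + \<alpha>\<close> the operator \<open>T\<^sup>2 - \<alpha>\<^sup>2\<close> is a compact positive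
  operator minus a positive operator of finite rank, and the form of such an operator attains its
  supremum on the unit sphere of every closed subspace.\<close>

section \<open>Complex inner products\<close>

text \<open>No spectral theorem is invoked: all eigenvectors come from maximisation. Norm attainment
  concerns \<open>norm (T x)\<close>, whose square is the form of T^2, so a maximiser first yields
  an eigenvector of T^2; positivity of T brings it back to T. In the converse direction squaring
  turns the problem into one about the compact operator T^2 - \<alpha>^2. A compact form attains a
  positive supremum, but a supremum 0 can be missed: minus an injective compact positive operator,
  in infinite dimension, attains none. This is where the finite rank of F enters, since every
  infinite-dimensional subspace must then meet the kernel of F. Values climbing strictly to a
  supremum are also what the mixing of eigenvectors manufactures in the forward direction. The e n
  need not be complete; on the orthogonal complement of all of them the norm of T is at most
  \<alpha>, which is why F is positive. Uniqueness rests on two facts: two candidate scalars differ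
  by a compact multiple of the identity, which vanishes in infinite dimension, and K and F are the
  positive and negative parts of T - \<alpha>.\<close>

lemma cinner_add_right: "cinner x (y + z) = cinner x y + cinner x z"
  by (metis cinner_add_left cinner_commute complex_cnj_add)

lemma cinner_scaleC_right: "cinner x (a *\<^sub>C y) = cnj a * cinner x y"
  by (metis cinner_scaleC_left cinner_commute complex_cnj_mult)

lemma cinner_zero_left [simp]: "cinner 0 x = 0"
  by (metis add_cancel_right_left cinner_add_left)

lemma cinner_zero_right [simp]: "cinner x 0 = 0"
  by (metis add_cancel_right_left cinner_add_right)

lemma cinner_scaleR_left: "cinner (r *\<^sub>R x) y = complex_of_real r * cinner x y"
  by (simp add: scaleR_eq_scaleC cinner_scaleC_left)

lemma cinner_scaleR_right: "cinner x (r *\<^sub>R y) = complex_of_real r * cinner x y"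
  by (simp add: scaleR_eq_scaleC cinner_scaleC_right)

lemma cinner_diff_left: "cinner (x - y) z = cinner x z - cinner y z"
  using cinner_add_left[of "x - y" y z] by simp

lemma cinner_sum_left: "cinner (\<Sum>i\<in>I. f i) y = (\<Sum>i\<in>I. cinner (f i) y)"
  by (induction I rule: infinite_finite_induct) (auto simp: cinner_add_left)

lemma cinner_sum_right: "cinner x (\<Sum>i\<in>I. f i) = (\<Sum>i\<in>I. cinner x (f i))"
  by (induction I rule: infinite_finite_induct) (auto simp: cinner_add_right)

lemma cinner_self: "cinner x x = complex_of_real ((norm x)\<^sup>2)"
proof (rule complex_eqI)
  show "Re (cinner x x) = Re (complex_of_real ((norm x)\<^sup>2))"
    by (simp add: inner_eq_Re_cinner[symmetric] power2_norm_eq_inner)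
  have "Im (cinner x x) = - Im (cinner x x)"
    by (metis cinner_commute cnj.simps(2))
  then show "Im (cinner x x) = Im (complex_of_real ((norm x)\<^sup>2))"
    by simp
qed

lemma norm_scaleC: "norm (c *\<^sub>C x) = cmod c * norm x"
proof -
  have "complex_of_real ((norm (c *\<^sub>C x))\<^sup>2) = (c * cnj c) * cinner x x"
    by (simp only: cinner_self[symmetric] cinner_scaleC_left cinner_scaleC_right mult.assoc)
      (simp only: mult.left_commute)
  also have "\<dots> = complex_of_real ((cmod c * norm x)\<^sup>2)"
    by (simp add: cinner_self complex_norm_square[symmetric] power_mult_distrib)
  finally have "(norm (c *\<^sub>C x))\<^sup>2 = (cmod c * norm x)\<^sup>2"
    using of_real_eq_iff by blast
  then show ?thesis
    by (simp add: power2_eq_iff_nonneg)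
qed

lemma Im_cinner: "Im (cinner x y) = - ((\<i> *\<^sub>C x) \<bullet> y)"
  by (simp add: inner_eq_Re_cinner cinner_scaleC_left)

lemma cmod_cinner_le: "cmod (cinner x y) \<le> norm x * norm y"
proof (cases "cinner x y = 0")
  case False
  \<comment> \<open>A unimodular factor that rotates the inner product onto the nonnegative real
    axis, where the real Cauchy-Schwarz inequality applies.\<close>
  define c where "c = cnj (cinner x y) / complex_of_real (cmod (cinner x y))"
  have "cmod c = 1"
    using False by (simp add: c_def norm_divide)
  have "c * cinner x y = complex_of_real (cmod (cinner x y))"
    using False complex_norm_square[of "cinner x y"]
    by (simp add: c_def field_simps power2_eq_square)
  then have "cmod (cinner x y) = (c *\<^sub>C x) \<bullet> y"
    by (simp add: inner_eq_Re_cinner cinner_scaleC_left)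
  also have "\<dots> \<le> norm (c *\<^sub>C x) * norm y"
    by (rule norm_cauchy_schwarz)
  finally show ?thesis
    by (simp add: norm_scaleC \<open>cmod c = 1\<close>)
qed simp

lemma bounded_linear_scaleC_left: "bounded_linear (\<lambda>z. z *\<^sub>C x)"
  by (rule bounded_linear_intro[of _ "norm x"])
    (simp_all add: scaleC_add_left norm_scaleC scaleR_eq_scaleC scaleC_scaleC scaleR_conv_of_real)

lemma bounded_linear_scaleC_right: "bounded_linear (\<lambda>x. c *\<^sub>C x)"
  by (rule bounded_linear_intro[of _ "cmod c"])
    (simp_all add: scaleC_add_right norm_scaleC scaleR_eq_scaleC scaleC_scaleC mult.commute)

lemma bounded_linear_cinner_left: "bounded_linear (\<lambda>x. cinner x y)"
  by (rule bounded_linear_intro[of _ "norm y"])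
    (simp_all add: cinner_add_left cinner_scaleR_left scaleR_conv_of_real cmod_cinner_le)

lemma csubspace_subspace: "csubspace S \<Longrightarrow> subspace S"
  by (intro subspaceI) (auto simp: scaleR_eq_scaleC complex_vector.subspace_0
      complex_vector.subspace_add complex_vector.subspace_scale)

lemma csubspace_closure:
  assumes "csubspace S"
  shows "csubspace (closure S)"
proof (rule complex_vector.subspaceI)
  show "0 \<in> closure S"
    using assms closure_subset complex_vector.subspace_0 by blast
  show "x + y \<in> closure S" if xy: "x \<in> closure S" "y \<in> closure S" for x y
  proof -
    obtain f g where "\<And>n. f n \<in> S" "f \<longlonglongrightarrow> x" "\<And>n. g n \<in> S" "g \<longlonglongrightarrow> y"
      using xy unfolding closure_sequential by metis
    then have "\<And>n. f n + g n \<in> S" "(\<lambda>n. f n + g n) \<longlonglongrightarrow> x + y"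
      using assms complex_vector.subspace_add by (blast, intro tendsto_add)
    then show ?thesis
      unfolding closure_sequential by (intro exI[of _ "\<lambda>n. f n + g n"]) auto
  qed
  show "c *\<^sub>C x \<in> closure S" if x: "x \<in> closure S" for c x
  proof -
    obtain f where "\<And>n. f n \<in> S" "f \<longlonglongrightarrow> x"
      using x unfolding closure_sequential by blast
    then have "\<And>n. c *\<^sub>C f n \<in> S" "(\<lambda>n. c *\<^sub>C f n) \<longlonglongrightarrow> c *\<^sub>C x"
      using assms complex_vector.subspace_scale
      by (blast, intro bounded_linear.tendsto[OF bounded_linear_scaleC_right])
    then show ?thesis
      unfolding closure_sequential by (intro exI[of _ "\<lambda>n. c *\<^sub>C f n"]) auto
  qed
qed

section \<open>Bounded operators\<close>

lemma bounded_clinearD: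
  assumes "bounded_clinear T"
  shows "bounded_linear T" "T (x + y) = T x + T y" "T (x - y) = T x - T y" "T 0 = 0"
    "T (r *\<^sub>R x) = r *\<^sub>R T x" "T (c *\<^sub>C x) = c *\<^sub>C T x" "T (\<Sum>i\<in>I. f i) = (\<Sum>i\<in>I. T (f i))"
proof -
  show T: "bounded_linear T" and "T (c *\<^sub>C x) = c *\<^sub>C T x"
    using assms by (auto simp: bounded_clinear_def)
  interpret bounded_linear T
    by (rule T)
  show "T (x + y) = T x + T y" "T (x - y) = T x - T y" "T 0 = 0"
    "T (r *\<^sub>R x) = r *\<^sub>R T x" "T (\<Sum>i\<in>I. f i) = (\<Sum>i\<in>I. T (f i))"
    by (auto simp: add diff scaleR sum zero)
qed

lemma bounded_clinear_intro:
  assumes "\<And>x y. T (x + y) = T x + T y" "\<And>c x. T (c *\<^sub>C x) = c *\<^sub>C T x" "\<And>x. norm (T x) \<le> norm x * C"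
  shows "bounded_clinear T"
  using assms unfolding bounded_clinear_def
  by (auto intro!: bounded_linear_intro[of _ C] simp: scaleR_eq_scaleC)

lemma bounded_clinear_add:
  "bounded_clinear S \<Longrightarrow> bounded_clinear T \<Longrightarrow> bounded_clinear (\<lambda>x. S x + T x)"
  by (simp add: bounded_clinear_def bounded_linear_add scaleC_add_right)

lemma bounded_clinear_scaleR: "bounded_clinear T \<Longrightarrow> bounded_clinear (\<lambda>x. r *\<^sub>R T x)"
  using bounded_linear_compose[OF bounded_linear_scaleC_right, of T "complex_of_real r"]
  by (simp add: bounded_clinear_def scaleR_eq_scaleC scaleC_scaleC mult.commute)

lemma bounded_clinear_diff:
  assumes "bounded_clinear S" "bounded_clinear T"
  shows "bounded_clinear (\<lambda>x. S x - T x)"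
  using bounded_clinear_add[OF assms(1) bounded_clinear_scaleR[OF assms(2), of "-1"]] by simp

lemma bounded_clinear_compose:
  "bounded_clinear S \<Longrightarrow> bounded_clinear T \<Longrightarrow> bounded_clinear (\<lambda>x. S (T x))"
  by (simp add: bounded_clinear_def bounded_linear_compose)

lemma bounded_clinear_id: "bounded_clinear (\<lambda>x. x)"
  by (simp add: bounded_clinear_def bounded_linear_ident)

lemma bounded_clinear_zero: "bounded_clinear (\<lambda>x. 0)"
  by (simp add: bounded_clinear_def bounded_linear_zero)

text \<open>By complex linearity the imaginary part of the inner product is itself a real inner
  product with \<open>\<i> *\<^sub>C x\<close>. This allows most later symmetry computations to be
  done with \<open>\<bullet>\<close>.\<close>

lemma selfadjoint_op_iff:
  "selfadjoint_op T \<longleftrightarrow> bounded_clinear T \<and> (\<forall>x y. T x \<bullet> y = x \<bullet> T y)"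
proof -
  have "cinner (T x) y = cinner x (T y)"
    if "bounded_clinear T" and sym: "\<forall>x y. T x \<bullet> y = x \<bullet> T y" for x y
  proof (rule complex_eqI)
    show "Re (cinner (T x) y) = Re (cinner x (T y))"
      using sym by (simp add: inner_eq_Re_cinner)
    have "\<i> *\<^sub>C T x \<bullet> y = \<i> *\<^sub>C x \<bullet> T y"
      using sym by (simp add: bounded_clinearD(6)[OF that(1), symmetric])
    then show "Im (cinner (T x) y) = Im (cinner x (T y))"
      by (simp add: Im_cinner)
  qed
  then show ?thesis
    unfolding selfadjoint_op_def is_cadjoint_def by (metis inner_eq_Re_cinner)
qed

lemma selfadjoint_cinner: "selfadjoint_op T \<Longrightarrow> cinner (T x) y = cinner x (T y)"
  by (simp add: selfadjoint_op_def is_cadjoint_def)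

lemma positive_op_iff:
  "positive_op T \<longleftrightarrow> bounded_clinear T \<and> (\<forall>x y. T x \<bullet> y = x \<bullet> T y) \<and> (\<forall>x. T x \<bullet> x \<ge> 0)"
proof -
  have "Im (cinner (T x) x) = 0" if "selfadjoint_op T" for x
    using selfadjoint_cinner[OF that, of x x] cinner_commute[of x "T x"]
    by (metis Reals_cnj_iff complex_is_Real_iff)
  then show ?thesis
    unfolding positive_op_def selfadjoint_op_iff[symmetric]
    by (auto simp: complex_nonneg_Reals_iff inner_eq_Re_cinner selfadjoint_op_iff)
qed

lemma positive_opD:
  assumes "positive_op T"
  shows "bounded_clinear T" "selfadjoint_op T" "T x \<bullet> y = x \<bullet> T y" "T x \<bullet> x \<ge> 0"
  using assms by (auto simp: positive_op_iff selfadjoint_op_iff)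

lemma le_op_zero_iff: "le_op (\<lambda>x. 0) F \<longleftrightarrow> positive_op F"
  by (auto simp: le_op_def selfadjoint_op_iff bounded_clinear_zero positive_op_iff)

lemma le_op_scaleR_iff:
  "le_op F (\<lambda>x. \<alpha> *\<^sub>R x) \<longleftrightarrow> selfadjoint_op F \<and> (\<forall>x. F x \<bullet> x \<le> \<alpha> * (x \<bullet> x))"
  by (auto simp: le_op_def selfadjoint_op_iff positive_op_iff bounded_clinear_diff
      bounded_clinear_scaleR bounded_clinear_id inner_diff_left inner_diff_right)

text \<open>Perturbing x in the direction T x changes the form by -2tN to first order in t; for
  small t > 0 this would make it negative unless N = 0.\<close>

lemma positive_op_kernel:
  assumes "positive_op T" "T x \<bullet> x = 0"
  shows "T x = 0"
proof (rule ccontr)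
  assume "T x \<noteq> 0"
  note T = positive_opD[OF assms(1)]
  define N where "N = T x \<bullet> T x"
  define M where "M = T (T x) \<bullet> T x"
  have "N > 0" "M \<ge> 0"
    using \<open>T x \<noteq> 0\<close> T(4) by (auto simp: N_def M_def)
  have *: "0 \<le> - 2 * t * N + t\<^sup>2 * M" for t
  proof -
    have "0 \<le> T (x - t *\<^sub>R T x) \<bullet> (x - t *\<^sub>R T x)"
      by (rule T(4))
    also have "\<dots> = - 2 * t * N + t\<^sup>2 * M"
      using assms(2) T(3)[of "T x" x]
      by (simp add: bounded_clinearD[OF T(1)] inner_diff_left inner_diff_right N_def M_def
          power2_eq_square inner_commute)
    finally show ?thesis .
  qed
  \<comment> \<open>The summand 1 avoids division by zero and makes t * M strictly smaller than
    N.\<close>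
  define t where "t = N / (M + 1)"
  have "t > 0" "t * M < N"
    using \<open>N > 0\<close> \<open>M \<ge> 0\<close> by (auto simp: t_def field_simps)
  have "t * (2 * N - t * M) > 0"
    using \<open>t > 0\<close> \<open>t * M < N\<close> \<open>N > 0\<close> by (intro mult_pos_pos) auto
  with *[of t] show False
    by (simp add: power2_eq_square algebra_simps)
qed

text \<open>The quotients are bounded by \<open>onorm T\<close>, so the supremum is a genuine one.
  At y = 0 both sides are harmless: the quotient is 0 / 0 = 0, and T 0 = 0. All later arguments use
  this form without a supremum.\<close>

lemma norm_attaining_on_iff:
  assumes "bounded_linear T" "subspace M"
  shows "norm_attaining_on M T \<longleftrightarrow> (\<exists>x\<in>M. norm x = 1 \<and> (\<forall>y\<in>M. norm (T y) \<le> norm (T x) * norm y))"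
proof -
  have bdd: "bdd_above ((\<lambda>x. norm (T x) / norm x) ` M)"
    by (rule bdd_aboveI2[of _ _ "onorm T"]) (rule le_onorm[OF assms(1)])
  have T0: "T 0 = 0"
    by (rule linear_0) (rule bounded_linear.linear[OF assms(1)])
  have "norm (T x) = onorm_on M T \<longleftrightarrow> (\<forall>y\<in>M. norm (T y) \<le> norm (T x) * norm y)"
    if x: "x \<in> M" "norm x = 1" for x
  proof -
    have le: "norm (T x) \<le> onorm_on M T"
      unfolding onorm_on_def using cSUP_upper[OF x(1) bdd] x(2) by simp
    have "onorm_on M T \<le> norm (T x) \<longleftrightarrow> (\<forall>y\<in>M. norm (T y) / norm y \<le> norm (T x))"
      unfolding onorm_on_def using x(1) bdd by (subst cSUP_le_iff) auto
    also have "\<dots> \<longleftrightarrow> (\<forall>y\<in>M. norm (T y) \<le> norm (T x) * norm y)"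
      by (rule ball_cong) (auto simp: T0 divide_le_eq)
    finally show ?thesis
      using le by auto
  qed
  then show ?thesis
    unfolding norm_attaining_on_def by blast
qed

section \<open>Orthonormal systems\<close>

definition orthonormal :: "'i set \<Rightarrow> ('i \<Rightarrow> 'a::complex_hilbert) \<Rightarrow> bool" where
  "orthonormal I e \<longleftrightarrow> (\<forall>i\<in>I. \<forall>j\<in>I. cinner (e i) (e j) = (if i = j then 1 else 0))"

lemma orthonormal_subset: "orthonormal I e \<Longrightarrow> J \<subseteq> I \<Longrightarrow> orthonormal J e"
  by (simp add: orthonormal_def subset_iff)

lemma orthonormal_norm: "orthonormal I e \<Longrightarrow> i \<in> I \<Longrightarrow> norm (e i) = 1"
proof -
  assume "orthonormal I e" "i \<in> I"
  then have "complex_of_real ((norm (e i))\<^sup>2) = complex_of_real 1"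
    by (simp add: cinner_self[symmetric] orthonormal_def del: of_real_power)
  then show ?thesis
    by (simp only: of_real_eq_iff) (simp add: power2_eq_1_iff, smt (verit) norm_ge_zero)
qed

lemma cinner_sum_orthonormal:
  assumes "finite I" "orthonormal I e" "j \<in> I"
  shows "cinner (\<Sum>i\<in>I. c i *\<^sub>C e i) (e j) = c j"
proof -
  have "cinner (\<Sum>i\<in>I. c i *\<^sub>C e i) (e j) = (\<Sum>i\<in>I. c i * cinner (e i) (e j))"
    by (simp add: cinner_sum_left cinner_scaleC_left)
  also have "\<dots> = (\<Sum>i\<in>I. if i = j then c i else 0)"
    using assms by (intro sum.cong) (auto simp: orthonormal_def)
  finally show ?thesis
    using assms by simp
qed

lemma norm_sum_orthonormal:
  assumes "finite I" "orthonormal I e"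
  shows "(norm (\<Sum>i\<in>I. c i *\<^sub>C e i))\<^sup>2 = (\<Sum>i\<in>I. (cmod (c i))\<^sup>2)"
proof -
  let ?s = "\<Sum>i\<in>I. c i *\<^sub>C e i"
  have "complex_of_real ((norm ?s)\<^sup>2) = (\<Sum>j\<in>I. cnj (c j) * cinner ?s (e j))"
    by (subst cinner_self[symmetric], subst cinner_sum_right) (simp add: cinner_scaleC_right)
  also have "\<dots> = (\<Sum>j\<in>I. cnj (c j) * c j)"
    using assms by (intro sum.cong) (auto simp: cinner_sum_orthonormal)
  also have "\<dots> = complex_of_real (\<Sum>i\<in>I. (cmod (c i))\<^sup>2)"
    by (simp only: of_real_sum complex_norm_square mult.commute)
  finally show ?thesis
    using of_real_eq_iff by blast
qed

lemma bessel_identity: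
  assumes "finite I" "orthonormal I e"
  shows "(norm x)\<^sup>2 = (\<Sum>i\<in>I. (cmod (cinner x (e i)))\<^sup>2)
    + (norm (x - (\<Sum>i\<in>I. cinner x (e i) *\<^sub>C e i)))\<^sup>2"
proof -
  let ?p = "\<Sum>i\<in>I. cinner x (e i) *\<^sub>C e i"
  have "cinner (x - ?p) ?p = 0"
    by (subst cinner_sum_right)
      (auto simp: cinner_scaleC_right cinner_diff_left cinner_sum_orthonormal[OF assms] intro!: sum.neutral)
  then have "?p \<bullet> (x - ?p) = 0"
    by (subst inner_commute) (simp add: inner_eq_Re_cinner)
  then have "(norm (?p + (x - ?p)))\<^sup>2 = (norm ?p)\<^sup>2 + (norm (x - ?p))\<^sup>2"
    by (rule norm_add_Pythagorean[unfolded orthogonal_def])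
  then show ?thesis
    by (simp add: norm_sum_orthonormal[OF assms])
qed

lemma bessel_inequality:
  assumes "finite I" "orthonormal I e"
  shows "(\<Sum>i\<in>I. (cmod (cinner x (e i)))\<^sup>2) \<le> (norm x)\<^sup>2"
  using bessel_identity[OF assms, of x] by simp

lemma span_orthonormal_expansion:
  assumes "finite I" "orthonormal I e" "x \<in> cspan (e ` I)"
  shows "x = (\<Sum>i\<in>I. cinner x (e i) *\<^sub>C e i)"
  using assms(3)
proof (induction rule: complex_vector.span_induct_alt)
  case (step c x y)
  then obtain j where j: "j \<in> I" "x = e j"
    by blast
  have "(\<Sum>i\<in>I. cinner x (e i) *\<^sub>C e i) = (\<Sum>i\<in>I. if i = j then e i else 0)"
    using assms(2) j by (intro sum.cong) (auto simp: orthonormal_def scaleC_one)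
  then have "(\<Sum>i\<in>I. cinner x (e i) *\<^sub>C e i) = x"
    using j assms(1) by simp
  moreover have "(\<Sum>i\<in>I. cinner (c *\<^sub>C x + y) (e i) *\<^sub>C e i)
      = c *\<^sub>C (\<Sum>i\<in>I. cinner x (e i) *\<^sub>C e i) + (\<Sum>i\<in>I. cinner y (e i) *\<^sub>C e i)"
    by (simp add: cinner_add_left cinner_scaleC_left scaleC_add_left
        sum.distrib complex_vector.scale_sum_right)
  ultimately show ?case
    using step by simp
qed simp

text \<open>Gram-Schmidt, by induction on a finite spanning set. A vector whose component w
  orthogonal to the previous span is zero contributes nothing; otherwise the normalised w is
  appended.\<close>

lemma cfinite_dim_orthonormal:
  assumes "cfinite_dim S"
  obtains n :: nat and u where "orthonormal {..<n} u" "S = cspan (u ` {..<n})"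
proof -
  obtain B where "finite B" "S = cspan B"
    using assms by (auto simp: cfinite_dim_def)
  have "\<exists>(n::nat) u. orthonormal {..<n} u \<and> cspan B = cspan (u ` {..<n})"
    using \<open>finite B\<close>
  proof induction
    case empty
    have "orthonormal {..<0::nat} (\<lambda>_. 0::'a) \<and> cspan {} = cspan ((\<lambda>_. 0::'a) ` {..<0::nat})"
      by (simp add: orthonormal_def)
    then show ?case
      by blast
  next
    case (insert b B)
    then obtain n :: nat and u where u: "orthonormal {..<n} u" "cspan B = cspan (u ` {..<n})"
      by blast
    define p where "p = (\<Sum>i<n. cinner b (u i) *\<^sub>C u i)"
    define w where "w = b - p"
    have p: "p \<in> cspan B"
      unfolding p_def u(2)
      by (intro complex_vector.span_sum complex_vector.span_scale complex_vector.span_base) auto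
    have w: "cinner w (u i) = 0" if "i < n" for i
      unfolding w_def p_def cinner_diff_left
      using that by (subst cinner_sum_orthonormal[OF finite_lessThan u(1)]) auto
    show ?case
    proof (cases "w = 0")
      case True
      then have "cspan (insert b B) = cspan B"
        using p by (simp add: w_def complex_vector.span_redundant)
      then show ?thesis
        using u by blast
    next
      case False
      define v where "v = complex_of_real (1 / norm w) *\<^sub>C w"
      have wv: "w = complex_of_real (norm w) *\<^sub>C v"
        using False by (simp add: v_def scaleC_scaleC scaleC_one)
      have "cinner v v = 1"
        using False by (simp add: v_def cinner_self norm_scaleC norm_divide)
      have v: "cinner v (u i) = 0" "cinner (u i) v = 0" if "i < n" for i
        using w[OF that] cinner_commute[of "u i" v] by (auto simp: v_def cinner_scaleC_left)
      define u' where "u' = u(n := v)"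
      have "orthonormal {..<Suc n} u'"
        using u(1) v \<open>cinner v v = 1\<close>
        by (auto simp: orthonormal_def u'_def less_Suc_eq)
      have im: "u' ` {..<Suc n} = insert v (u ` {..<n})"
        by (auto simp: u'_def lessThan_Suc)
      have "cspan (insert b B) = cspan (insert v B)"
      proof (rule complex_vector.span_unique[symmetric, OF _ complex_vector.subspace_span, symmetric])
        have "b = complex_of_real (norm w) *\<^sub>C v + p"
          unfolding wv[symmetric] by (simp add: w_def)
        moreover have "p \<in> cspan (insert v B)"
          using p complex_vector.span_mono[of B "insert v B"] by blast
        ultimately have "b \<in> cspan (insert v B)"
          by (simp add: complex_vector.span_add complex_vector.span_base complex_vector.span_scale)
        then show "insert b B \<subseteq> cspan (insert v B)"
          by (auto intro: complex_vector.span_base)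
        fix V assume V: "insert b B \<subseteq> V" "csubspace V"
        have "p \<in> V"
          using p V complex_vector.span_minimal[of B V] by blast
        then have "v \<in> V"
          using V unfolding v_def w_def
          by (auto intro!: complex_vector.subspace_scale complex_vector.subspace_diff)
        then show "cspan (insert v B) \<subseteq> V"
          using V complex_vector.span_minimal[of "insert v B" V] by blast
      qed
      also have "\<dots> = cspan (insert v (u ` {..<n}))"
        using u(2) by (metis complex_vector.span_insert)
      finally have "cspan (insert b B) = cspan (u' ` {..<Suc n})"
        by (simp add: im)
      then show ?thesis
        using \<open>orthonormal {..<Suc n} u'\<close> by blast
    qed
  qed
  then show ?thesis
    using that \<open>S = cspan B\<close> by blast
qed

lemma cfinite_dim_subset:
  assumes "csubspace R" "cfinite_dim S" "R \<subseteq> S"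
  shows "cfinite_dim R"
proof -
  obtain B where B: "finite B" "cspan B = S"
    using assms(2) by (auto simp: cfinite_dim_def)
  obtain C where C: "C \<subseteq> R" "\<not> complex_vector.dependent C" "R \<subseteq> cspan C"
    by (rule complex_vector.maximal_independent_subset)
  have "finite C"
    using complex_vector.independent_span_bound[OF B(1) C(2)] C(1) assms(3) B(2) by blast
  moreover have "cspan C = R"
    using C assms(1) by (metis complex_vector.span_subspace)
  ultimately show ?thesis
    by (auto simp: cfinite_dim_def)
qed

section \<open>Compact operators\<close>

lemma compact_opI:
  assumes "bounded_clinear T" "T ` cball 0 1 \<subseteq> C" "compact C"
  shows "compact_op T"
proof -
  have "closure (T ` cball 0 1) \<subseteq> C"
    using assms by (simp add: closure_minimal compact_imp_closed)
  then have "compact (C \<inter> closure (T ` cball 0 1))"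
    using assms(3) by (intro compact_Int_closed) auto
  then show ?thesis
    using assms(1) \<open>closure (T ` cball 0 1) \<subseteq> C\<close> by (simp add: compact_op_def Int_absorb1)
qed

lemma compact_op_add:
  assumes "compact_op S" "compact_op T"
  shows "compact_op (\<lambda>x. S x + T x)"
proof (rule compact_opI)
  show "bounded_clinear (\<lambda>x. S x + T x)"
    using assms by (auto simp: compact_op_def intro: bounded_clinear_add)
  let ?C = "{x + y | x y. x \<in> closure (S ` cball 0 1) \<and> y \<in> closure (T ` cball 0 1)}"
  show "compact ?C"
    using assms by (intro compact_sums) (auto simp: compact_op_def)
  show "(\<lambda>x. S x + T x) ` cball 0 1 \<subseteq> ?C"
    using closure_subset[of "S ` cball 0 1"] closure_subset[of "T ` cball 0 1"] by blast
qed

lemma compact_op_compose_left: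
  assumes "bounded_clinear S" "compact_op T"
  shows "compact_op (\<lambda>x. S (T x))"
proof (rule compact_opI)
  show "bounded_clinear (\<lambda>x. S (T x))"
    using assms by (auto simp: compact_op_def intro: bounded_clinear_compose)
  show "compact (S ` closure (T ` cball 0 1))"
    using assms by (intro compact_continuous_image)
      (auto simp: compact_op_def bounded_clinear_def intro: linear_continuous_on)
  show "(\<lambda>x. S (T x)) ` cball 0 1 \<subseteq> S ` closure (T ` cball 0 1)"
    using closure_subset[of "T ` cball 0 1"] by blast
qed

lemma compact_op_scaleR: "compact_op T \<Longrightarrow> compact_op (\<lambda>x. r *\<^sub>R T x)"
  using compact_op_compose_left[OF bounded_clinear_scaleR[OF bounded_clinear_id]] by blast

lemma compact_op_diff:
  assumes "compact_op S" "compact_op T"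
  shows "compact_op (\<lambda>x. S x - T x)"
  using compact_op_add[OF assms(1) compact_op_scaleR[OF assms(2), of "-1"]] by simp

lemma compact_op_convergent_subseq:
  assumes "compact_op T" "\<And>n. norm (x n) \<le> 1"
  obtains r l where "strict_mono (r :: nat \<Rightarrow> nat)" "(\<lambda>n. T (x (r n))) \<longlonglongrightarrow> l"
proof -
  have "seq_compact (closure (T ` cball 0 1))"
    using assms(1) by (simp add: compact_op_def compact_imp_seq_compact)
  moreover have "\<forall>n. T (x n) \<in> closure (T ` cball 0 1)"
    using assms(2) closure_subset[of "T ` cball 0 1"] by auto
  ultimately obtain l r where "strict_mono r" "((\<lambda>n. T (x n)) \<circ> r) \<longlonglongrightarrow> l"
    by (rule seq_compactE)
  then show ?thesis
    using that by (simp add: comp_def)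
qed

text \<open>Each summand ranges over the continuous image of a closed disc, and sums of compact sets
  are compact.\<close>

lemma compact_box:
  fixes u :: "nat \<Rightarrow> 'a::complex_hilbert"
  shows "compact {\<Sum>i<n. z i *\<^sub>C u i | z. \<forall>i<n. cmod (z i) \<le> r}"
proof (induction n)
  case (Suc n)
  let ?B = "\<lambda>n. {\<Sum>i<n. z i *\<^sub>C u i | z. \<forall>i<n. cmod (z i) \<le> r}"
  have "compact ((\<lambda>z. z *\<^sub>C u n) ` cball 0 r)"
    by (intro compact_continuous_image linear_continuous_on bounded_linear_scaleC_left) auto
  with Suc have "compact {x + y | x y. x \<in> ?B n \<and> y \<in> (\<lambda>z. z *\<^sub>C u n) ` cball 0 r}"
    by (rule compact_sums)
  moreover have "{x + y | x y. x \<in> ?B n \<and> y \<in> (\<lambda>z. z *\<^sub>C u n) ` cball 0 r} = ?B (Suc n)"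
  proof safe
    fix z :: "nat \<Rightarrow> complex" and w :: complex assume *: "\<forall>i<n. cmod (z i) \<le> r" "w \<in> cball 0 r"
    show "\<exists>z'. (\<Sum>i<n. z i *\<^sub>C u i) + w *\<^sub>C u n = (\<Sum>i<Suc n. z' i *\<^sub>C u i) \<and>
        (\<forall>i<Suc n. cmod (z' i) \<le> r)"
      by (rule exI[of _ "z(n := w)"]) (use * in \<open>auto simp: less_Suc_eq\<close>)
  next
    fix z :: "nat \<Rightarrow> complex" assume *: "\<forall>i<Suc n. cmod (z i) \<le> r"
    show "\<exists>x y. (\<Sum>i<Suc n. z i *\<^sub>C u i) = x + y \<and> x \<in> ?B n \<and> y \<in> (\<lambda>z. z *\<^sub>C u n) ` cball 0 r"
      by (intro exI[of _ "\<Sum>i<n. z i *\<^sub>C u i"] exI[of _ "z n *\<^sub>C u n"]) (use * in auto)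
  qed
  ultimately show ?case
    by simp
qed simp

text \<open>Coordinates with respect to an orthonormal basis are bounded by the norm, so a ball of S
  lies in a box. This gives compactness both for images of finite rank operators and for unit
  spheres of finite-dimensional subspaces.\<close>

lemma cfinite_dim_bounded_in_compact:
  assumes "cfinite_dim S"
  obtains C where "compact C" "S \<inter> cball 0 r \<subseteq> C"
proof -
  obtain n :: nat and u where u: "orthonormal {..<n} u" "S = cspan (u ` {..<n})"
    using cfinite_dim_orthonormal[OF assms] .
  have "S \<inter> cball 0 r \<subseteq> {\<Sum>i<n. z i *\<^sub>C u i | z. \<forall>i<n. cmod (z i) \<le> r}"
  proof safe
    fix x assume x: "x \<in> S" "x \<in> cball 0 r"
    have "cmod (cinner x (u i)) \<le> r" if "i < n" for i
      using cmod_cinner_le[of x "u i"] orthonormal_norm[OF u(1), of i] that x(2) by simp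
    then show "\<exists>z. x = (\<Sum>i<n. z i *\<^sub>C u i) \<and> (\<forall>i<n. cmod (z i) \<le> r)"
      using span_orthonormal_expansion[OF finite_lessThan u(1), of x] x(1) u(2)
      by (intro exI[of _ "\<lambda>i. cinner x (u i)"]) auto
  qed
  then show ?thesis
    by (rule that[OF compact_box])
qed

lemma finite_rank_compact:
  assumes "finite_rank_op F"
  shows "compact_op F"
proof -
  have F: "bounded_clinear F" "cfinite_dim (range F)"
    using assms by (auto simp: finite_rank_op_def)
  obtain C where C: "compact C" "range F \<inter> cball 0 (onorm F) \<subseteq> C"
    using cfinite_dim_bounded_in_compact[OF F(2)] .
  have "norm (F x) \<le> onorm F" if "norm x \<le> 1" for x
    using onorm[OF bounded_clinearD(1)[OF F(1)], of x] mult_left_mono[OF that, of "onorm F"]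
      onorm_pos_le[OF bounded_clinearD(1)[OF F(1)]] by simp
  then have "F ` cball 0 1 \<subseteq> C"
    using C(2) by auto
  then show ?thesis
    using compact_opI F(1) C(1) by blast
qed

lemma csubspace_range:
  assumes "bounded_clinear T"
  shows "csubspace (range T)"
  using rangeI[of T 0]
  by (intro complex_vector.subspaceI)
    (auto simp: bounded_clinearD(4)[OF assms] bounded_clinearD(2,6)[OF assms, symmetric])

text \<open>A finite \<epsilon>/4-net for the image of the unit ball under a close compact operator
  is an \<epsilon>/2-net for the image under T, so that image is totally bounded.\<close>

lemma compact_op_uniform_limit:
  assumes "bounded_clinear T" "\<And>\<epsilon>. \<epsilon> > 0 \<Longrightarrow> \<exists>S. compact_op S \<and> (\<forall>x. norm x \<le> 1 \<longrightarrow> norm (T x - S x) \<le> \<epsilon>)"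
  shows "compact_op T"
  unfolding compact_op_def compact_eq_totally_bounded
proof (intro conjI allI impI)
  show "complete (closure (T ` cball 0 1))"
    by (simp add: complete_eq_closed)
  fix \<epsilon> :: real assume "\<epsilon> > 0"
  then obtain S where S: "compact_op S" "\<And>x. norm x \<le> 1 \<Longrightarrow> norm (T x - S x) \<le> \<epsilon> / 4"
    using assms(2)[of "\<epsilon> / 4"] by auto
  obtain k where k: "finite k" "closure (S ` cball 0 1) \<subseteq> (\<Union>x\<in>k. ball x (\<epsilon> / 4))"
    using S(1) \<open>\<epsilon> > 0\<close> unfolding compact_op_def compact_eq_totally_bounded
    by (metis divide_pos_pos zero_less_numeral)
  \<comment> \<open>Closed balls make the finite union closed, so it contains the closure too; the
    slack between \<epsilon>/2 and \<epsilon> restores open balls.\<close>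
  have "T ` cball 0 1 \<subseteq> (\<Union>x\<in>k. cball x (\<epsilon> / 2))"
  proof clarify
    fix x :: 'a assume "x \<in> cball 0 1"
    moreover then obtain y where "y \<in> k" "dist y (S x) < \<epsilon> / 4"
      using k(2) closure_subset[of "S ` cball 0 1"] by fastforce
    ultimately have "dist y (T x) \<le> \<epsilon> / 2"
      using S(2)[of x] dist_triangle[of y "T x" "S x"] by (simp add: dist_norm norm_minus_commute)
    then show "T x \<in> (\<Union>x\<in>k. cball x (\<epsilon> / 2))"
      using \<open>y \<in> k\<close> by auto
  qed
  then have "closure (T ` cball 0 1) \<subseteq> (\<Union>x\<in>k. cball x (\<epsilon> / 2))"
    using k(1) by (intro closure_minimal closed_UN) auto
  also have "\<dots> \<subseteq> (\<Union>x\<in>k. ball x \<epsilon>)"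
    using \<open>\<epsilon> > 0\<close> by fastforce
  finally show "\<exists>k. finite k \<and> closure (T ` cball 0 1) \<subseteq> (\<Union>x\<in>k. ball x \<epsilon>)"
    using k(1) by blast
qed (fact assms)

text \<open>F maps a basis of M injectively to an independent set in a finite-dimensional range. In
  the converse direction this handles the subspaces that meet the kernel of F only in 0.\<close>

lemma cfinite_dim_if_inj_on:
  assumes "finite_rank_op F" "csubspace M" "\<And>x. x \<in> M \<Longrightarrow> F x = 0 \<Longrightarrow> x = 0"
  shows "cfinite_dim M"
proof -
  have F: "bounded_clinear F" "cfinite_dim (range F)"
    using assms(1) by (auto simp: finite_rank_op_def)
  interpret vector_space_pair "scaleC :: complex \<Rightarrow> 'a \<Rightarrow> 'a" "scaleC :: complex \<Rightarrow> 'b \<Rightarrow> 'b"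
    by unfold_locales
  have lin: "Vector_Spaces.linear scaleC scaleC F"
    unfolding Vector_Spaces.linear_iff
    by (simp add: bounded_clinearD[OF F(1)] complex_vector.vector_space_axioms)
  obtain C where C: "C \<subseteq> M" "\<not> complex_vector.dependent C" "M \<subseteq> cspan C"
    by (rule complex_vector.maximal_independent_subset)
  have M: "cspan C = M"
    using C assms(2) by (metis complex_vector.span_subspace)
  have inj: "inj_on F M"
  proof (rule inj_onI)
    fix x y assume "x \<in> M" "y \<in> M" "F x = F y"
    then show "x = y"
      using assms(3)[of "x - y"] complex_vector.subspace_diff[OF assms(2)]
      by (simp add: bounded_clinearD(3)[OF F(1)])
  qed
  have ind: "\<not> complex_vector.dependent (F ` C)"
    using linear_independent_injective_image[OF lin C(2)] inj M by (simp add: cspan_def)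
  obtain B where "finite B" "cspan B = range F"
    using F(2) by (auto simp: cfinite_dim_def)
  then have "finite (F ` C)"
    using complex_vector.independent_span_bound[OF _ ind] by blast
  then have "finite C"
    using inj C(1) by (metis finite_imageD inj_on_subset)
  then show ?thesis
    using M by (auto simp: cfinite_dim_def)
qed

section \<open>Maximising quadratic forms and norms\<close>

text \<open>A maximising sequence for a positive supremum \<open>s\<close> becomes a Cauchy sequence once its image
  under \<open>S\<close> converges: the form \<open>h y = s \<parallel>y\<parallel>\<^sup>2 - \<langle>S y, y\<rangle>\<close> is nonnegative on \<open>M\<close>, so
  \<open>h (x - y) \<le> 2 h x + 2 h y\<close>.\<close>

lemma compact_form_attains_sup:
  fixes S :: "'a::complex_hilbert \<Rightarrow> 'a"
  assumes S: "compact_op S" "selfadjoint_op S" and M: "subspace M" "closed M"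
    and x0: "x0 \<in> M" "S x0 \<bullet> x0 > 0"
  obtains x where "x \<in> M" "norm x = 1" "\<And>y. y \<in> M \<Longrightarrow> S y \<bullet> y \<le> (S x \<bullet> x) * (norm y)\<^sup>2"
proof -
  have bS: "bounded_clinear S"
    using S(1) by (simp add: compact_op_def)
  note lin = bounded_clinearD[OF bS]
  have sym: "S x \<bullet> y = x \<bullet> S y" for x y
    using S(2) by (simp add: selfadjoint_op_iff)
  define U where "U = {x\<in>M. norm x = 1}"
  define s where "s = (SUP x\<in>U. S x \<bullet> x)"
  have le_onorm: "S x \<bullet> x \<le> onorm S" if "norm x = 1" for x
    using norm_cauchy_schwarz[of "S x" x] onorm[OF lin(1), of x] that by simp
  then have bdd: "bdd_above ((\<lambda>x. S x \<bullet> x) ` U)"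
    by (intro bdd_aboveI2[of _ _ "onorm S"]) (auto simp: U_def)
  have normalize: "inverse (norm x) *\<^sub>R x \<in> U" if "x \<in> M" "x \<noteq> 0" for x
    using that M(1) by (auto simp: U_def subspace_scale)
  have form_scale: "S (r *\<^sub>R x) \<bullet> (r *\<^sub>R x) = r\<^sup>2 * (S x \<bullet> x)" for r x
    by (simp add: lin power2_eq_square)
  have h0: "S x \<bullet> x \<le> s * (norm x)\<^sup>2" if "x \<in> M" for x
  proof (cases "x = 0")
    case False
    have "(inverse (norm x))\<^sup>2 * (S x \<bullet> x) \<le> s"
      unfolding s_def form_scale[symmetric] by (rule cSUP_upper[OF normalize[OF that False] bdd])
    then show ?thesis
      using False by (simp add: field_simps power2_eq_square)
  qed (simp add: lin)
  have "x0 \<noteq> 0"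
    using x0(2) by auto
  have "s > 0"
    using h0[OF x0(1)] x0(2) by (smt (verit) mult_nonpos_nonneg zero_le_power2)
  define h where "h x = s * (norm x)\<^sup>2 - S x \<bullet> x" for x
  have "h (x - y) + h (x + y) = 2 * h x + 2 * h y" for x y
    by (simp add: h_def power2_norm_eq_inner lin inner_diff_left inner_diff_right
        inner_add_left inner_add_right algebra_simps)
  then have h_diff: "h (x - y) \<le> 2 * h x + 2 * h y" if "x \<in> M" "y \<in> M" for x y
    using h0[OF subspace_add[OF M(1) that]] unfolding h_def by smt
  have "\<exists>x\<in>U. S x \<bullet> x > s - 1 / Suc n" for n
    using less_cSUP_iff[OF _ bdd, of "s - 1 / Suc n"] normalize[OF x0(1) \<open>x0 \<noteq> 0\<close>]
    unfolding s_def[symmetric] by auto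
  then obtain x where x: "\<And>n. x n \<in> U" "\<And>n. S (x n) \<bullet> x n > s - 1 / Suc n"
    by metis
  have xM: "x n \<in> M" "norm (x n) = 1" for n
    using x(1)[of n] by (auto simp: U_def)
  obtain r l where r: "strict_mono (r :: nat \<Rightarrow> nat)" "(\<lambda>n. S (x (r n))) \<longlonglongrightarrow> l"
    using compact_op_convergent_subseq[OF S(1), of x] xM(2) by auto
  have hx: "h (x (r n)) < 1 / Suc n" for n
  proof -
    have "1 / real (Suc (r n)) \<le> 1 / Suc n"
      using seq_suble[OF r(1), of n] by (intro divide_left_mono) auto
    then show ?thesis
      using x(2)[of "r n"] xM(2)[of "r n"] by (simp add: h_def)
  qed
  have "Cauchy (\<lambda>n. x (r n))"
  proof (rule metric_CauchyI)
    fix e :: real assume "e > 0"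
    \<comment> \<open>For w the difference of two late terms, h w < 4 d by \<open>h_diff\<close>,
      and the form of S at w is below 2 d because \<open>norm w\<close> is at most 2. The sum 6 d
      bounds s times the squared norm of w and stays below 8 d = s * e^2.\<close>
    define d where "d = s * e\<^sup>2 / 8"
    have "d > 0"
      using \<open>s > 0\<close> \<open>e > 0\<close> by (simp add: d_def)
    obtain N1 where N1: "1 / Suc N1 < d"
      using nat_approx_posE[OF \<open>d > 0\<close>] by auto
    obtain N2 where N2: "\<And>m n. m \<ge> N2 \<Longrightarrow> n \<ge> N2 \<Longrightarrow> dist (S (x (r m))) (S (x (r n))) < d"
      using metric_CauchyD[OF LIMSEQ_imp_Cauchy[OF r(2)] \<open>d > 0\<close>] by blast
    have "dist (x (r m)) (x (r n)) < e" if "m \<ge> max N1 N2" "n \<ge> max N1 N2" for m n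
    proof -
      let ?w = "x (r m) - x (r n)"
      have small: "h (x (r k)) < d" if "k \<ge> N1" for k
      proof -
        have "1 / real (Suc k) \<le> 1 / Suc N1"
          using that by (intro divide_left_mono) auto
        then show ?thesis
          using hx[of k] N1 by linarith
      qed
      have "S ?w \<bullet> ?w \<le> norm (S ?w) * norm ?w"
        by (rule norm_cauchy_schwarz)
      also have "\<dots> \<le> norm (S ?w) * 2"
        using norm_triangle_ineq4[of "x (r m)" "x (r n)"] xM(2) by (intro mult_left_mono) auto
      also have "\<dots> < d * 2"
        using N2[of m n] that by (simp add: dist_norm lin)
      finally have "s * (norm ?w)\<^sup>2 < 6 * d"
        using h_diff[OF xM(1) xM(1), of "r m" "r n"] small[of m] small[of n] that
        unfolding h_def by simp
      also have "\<dots> < s * e\<^sup>2"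
        using \<open>s > 0\<close> \<open>e > 0\<close> by (simp add: d_def)
      finally have "(norm ?w)\<^sup>2 < e\<^sup>2"
        using \<open>s > 0\<close> by simp
      then show ?thesis
        using \<open>e > 0\<close> by (simp add: dist_norm power_less_imp_less_base)
    qed
    then show "\<exists>N. \<forall>m\<ge>N. \<forall>n\<ge>N. dist (x (r m)) (x (r n)) < e"
      by blast
  qed
  then obtain y where y: "(\<lambda>n. x (r n)) \<longlonglongrightarrow> y"
    by (auto simp: Cauchy_convergent_iff convergent_def)
  have "y \<in> M"
    using closed_sequentially[OF M(2) _ y] xM(1) by auto
  have "norm y = 1"
    using tendsto_norm[OF y] by (simp add: xM(2) LIMSEQ_const_iff)
  have "(\<lambda>n. S (x (r n)) \<bullet> x (r n)) \<longlonglongrightarrow> S y \<bullet> y"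
    by (intro tendsto_inner y bounded_linear.tendsto[OF lin(1)])
  moreover have "(\<lambda>n. s - 1 / Suc n) \<longlonglongrightarrow> s - 0"
    by (intro tendsto_diff tendsto_const LIMSEQ_Suc[OF lim_1_over_n])
  moreover have "s - 1 / Suc n \<le> S (x (r n)) \<bullet> x (r n)" for n
    using hx[of n] xM(2) by (simp add: h_def)
  ultimately have "s \<le> S y \<bullet> y"
    by (auto intro: LIMSEQ_le)
  then have "S z \<bullet> z \<le> (S y \<bullet> y) * (norm z)\<^sup>2" if "z \<in> M" for z
    using h0[OF that] by (meson mult_right_mono order_trans zero_le_power2)
  then show ?thesis
    using that \<open>y \<in> M\<close> \<open>norm y = 1\<close> by blast
qed

text \<open>If \<open>\<lambda> = \<parallel>T x\<parallel>\<close> is maximal on the unit sphere of \<open>R\<close> then \<open>T\<^sup>2 x = \<lambda>\<^sup>2 x\<close>, so \<open>(T - \<lambda>) x\<close> is either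
  zero or an eigenvector for \<open>-\<lambda>\<close>.\<close>

lemma norm_maximizer_square:
  assumes T: "selfadjoint_op T" and R: "T ` R \<subseteq> R"
    and x: "x \<in> R" "norm x = 1" "\<And>y. y \<in> R \<Longrightarrow> norm (T y) \<le> norm (T x) * norm y"
  shows "T (T x) = (norm (T x))\<^sup>2 *\<^sub>R x"
proof -
  define c where "c = norm (T x)"
  have "norm (T (T x)) \<le> c\<^sup>2"
    using x(3)[of "T x"] R x(1) by (auto simp: c_def power2_eq_square)
  then have 1: "(norm (T (T x)))\<^sup>2 \<le> (c\<^sup>2)\<^sup>2"
    by (intro power_mono) auto
  have 2: "T (T x) \<bullet> x = c\<^sup>2"
    using T by (simp add: selfadjoint_op_iff c_def power2_norm_eq_inner inner_commute)
  \<comment> \<open>Equality case of Cauchy-Schwarz: T (T x) has norm at most c^2, by maximality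
    applied to T x in R, and inner product exactly c^2 with the unit vector x.\<close>
  have "(norm (T (T x) - c\<^sup>2 *\<^sub>R x))\<^sup>2 = (norm (T (T x)))\<^sup>2 - 2 * c\<^sup>2 * (T (T x) \<bullet> x) + (c\<^sup>2)\<^sup>2 * (norm x)\<^sup>2"
    unfolding power2_norm_eq_inner
    by (simp add: inner_diff_left inner_diff_right inner_commute[of x "T (T x)"] power2_eq_square[of "c\<^sup>2"] algebra_simps)
  also have "\<dots> \<le> 0"
    using 1 unfolding 2 x(2) by (simp add: power2_eq_square)
  finally show ?thesis
    by (simp add: c_def)
qed

text \<open>Positivity of T excludes the eigenvalue \<open>- norm (T x)\<close> when T x is nonzero,
  so only the other factor of T^2 - \<lambda>^2 can vanish at x.\<close>

lemma norm_maximizer_eigenvector: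
  assumes T: "positive_op T" and R: "T ` R \<subseteq> R"
    and x: "x \<in> R" "norm x = 1" "\<And>y. y \<in> R \<Longrightarrow> norm (T y) \<le> norm (T x) * norm y"
  shows "T x = norm (T x) *\<^sub>R x"
proof (cases "T x = 0")
  case False
  define w where "w = T x - norm (T x) *\<^sub>R x"
  have "T w = - norm (T x) *\<^sub>R w"
    using norm_maximizer_square[OF positive_opD(2)[OF T] R x]
    by (simp add: w_def bounded_clinearD[OF positive_opD(1)[OF T]] algebra_simps power2_eq_square)
  then have "norm (T x) * (w \<bullet> w) \<le> 0"
    using positive_opD(4)[OF T, of w] by simp
  then have "w = 0"
    using False inner_gt_zero_iff[of w] by (smt (verit) mult_pos_pos zero_less_norm_iff)
  then show ?thesis
    by (simp add: w_def)
qed simp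

text \<open>The form of D^2 is the squared norm of D x, hence positive somewhere, and its maximum is
  attained by compactness. At a maximiser (D + c) (D - c) x = 0, so either x or (D - c) x is an
  eigenvector.\<close>

lemma compact_selfadjoint_eigenvector:
  assumes D: "compact_op D" "selfadjoint_op D" "D x0 \<noteq> 0"
  obtains c v where "c \<noteq> 0" "v \<noteq> 0" "D v = c *\<^sub>R v"
proof -
  have bD: "bounded_clinear D" and sym: "\<And>x y. D x \<bullet> y = x \<bullet> D y"
    using D(2) by (auto simp: selfadjoint_op_iff)
  note lin = bounded_clinearD[OF bD]
  have form: "D (D x) \<bullet> x = (norm (D x))\<^sup>2" for x
    by (simp add: sym[of "D x" x] power2_norm_eq_inner)
  have "selfadjoint_op (\<lambda>x. D (D x))"
    using sym by (simp add: selfadjoint_op_iff bounded_clinear_compose[OF bD bD])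
  moreover have "D (D x0) \<bullet> x0 > 0"
    using D(3) by (simp add: form)
  ultimately obtain x where x: "norm x = 1"
      "\<And>y. D (D y) \<bullet> y \<le> (D (D x) \<bullet> x) * (norm y)\<^sup>2"
    using compact_form_attains_sup[OF compact_op_compose_left[OF bD D(1)], of UNIV x0] by auto
  define c where "c = norm (D x)"
  have le: "norm (D y) \<le> c * norm y" for y
    using x(2)[of y] unfolding form power_mult_distrib[symmetric] c_def
    by (rule power2_le_imp_le) simp
  then have "c > 0"
    using D(3) le[of x0] by (auto simp: c_def)
  have sq: "D (D x) = c\<^sup>2 *\<^sub>R x"
    using norm_maximizer_square[OF D(2), of UNIV x] x(1) le by (simp add: c_def)
  show ?thesis
  proof (cases "D x = c *\<^sub>R x")
    case True
    moreover have "x \<noteq> 0"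
      using x(1) by auto
    ultimately show ?thesis
      using that[of c x] \<open>c > 0\<close> by auto
  next
    case False
    have "D (D x - c *\<^sub>R x) = - c *\<^sub>R (D x - c *\<^sub>R x)"
      using sq by (simp add: lin algebra_simps power2_eq_square)
    then show ?thesis
      using that[of "-c" "D x - c *\<^sub>R x"] False \<open>c > 0\<close> by auto
  qed
qed

section \<open>Operators of the form compact minus finite rank plus scalar\<close>

text \<open>FK is the adjoint of KF.\<close>

lemma selfadjoint_compose_zero_commute:
  assumes "selfadjoint_op K" "selfadjoint_op F" "\<And>x. K (F x) = 0"
  shows "F (K x) = 0"
proof -
  have "F (K x) \<bullet> F (K x) = x \<bullet> K (F (F (K x)))"
    using assms(1,2) by (simp add: selfadjoint_op_iff)
  then show ?thesis
    by (simp add: assms(3))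
qed

lemma positive_decomposition:
  assumes K: "positive_op K" and F: "positive_op F" "\<And>x. F x \<bullet> x \<le> \<alpha> * (x \<bullet> x)"
    and T: "\<And>x. T x = K x - F x + \<alpha> *\<^sub>R x"
  shows "positive_op T"
  unfolding positive_op_iff
proof (intro conjI allI)
  have T': "T = (\<lambda>x. K x - F x + \<alpha> *\<^sub>R x)"
    using T by auto
  show "bounded_clinear T"
    unfolding T' by (intro bounded_clinear_add bounded_clinear_diff bounded_clinear_scaleR
        bounded_clinear_id positive_opD(1)[OF K] positive_opD(1)[OF F(1)])
  show "T x \<bullet> y = x \<bullet> T y" for x y
    by (simp add: T inner_add_left inner_add_right inner_diff_left inner_diff_right
        positive_opD(3)[OF K] positive_opD(3)[OF F(1)])
  show "T x \<bullet> x \<ge> 0" for x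
    using positive_opD(4)[OF K, of x] F(2)[of x] by (simp add: T inner_add_left inner_diff_left)
qed

text \<open>Since \<open>K F = F K = 0\<close>, the operator \<open>T\<^sup>2 - \<alpha>\<^sup>2\<close> is compact and its form is nonnegative on
  the kernel of \<open>F\<close>. If the form is not positive anywhere on \<open>M\<close>, then either \<open>M\<close> meets the kernel
  of \<open>F\<close>, where the supremum 0 is attained, or \<open>M\<close> is finite-dimensional.\<close>

lemma decomposition_abs_norm_attaining:
  assumes K: "compact_op K" "positive_op K"
    and F: "finite_rank_op F" "positive_op F" "\<And>x. F x \<bullet> x \<le> \<alpha> * (x \<bullet> x)"
    and KF: "\<And>x. K (F x) = 0" and "\<alpha> \<ge> 0"
    and T: "\<And>x. T x = K x - F x + \<alpha> *\<^sub>R x"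
  shows "abs_norm_attaining T"
proof -
  note Kp = positive_opD[OF K(2)] and Fp = positive_opD[OF F(2)]
  note lin = bounded_clinearD[OF Kp(1)] bounded_clinearD[OF Fp(1)]
  have pT: "positive_op T"
    by (rule positive_decomposition[OF K(2) F(2,3) T])
  note Tp = positive_opD[OF pT]
  have FK: "F (K x) = 0" for x
    using selfadjoint_compose_zero_commute[OF Kp(2) Fp(2) KF] .
  \<comment> \<open>This is T^2 - \<alpha>^2 expanded, the mixed terms vanishing because KF = FK =
    0. On the kernel of F only K^2 + 2 \<alpha> K remains, which is positive.\<close>
  define S where "S = (\<lambda>x. (K (K x) + (2 * \<alpha>) *\<^sub>R K x) + (F (F x) - (2 * \<alpha>) *\<^sub>R F x))"
  have "compact_op F"
    by (rule finite_rank_compact[OF F(1)])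
  then have cS: "compact_op S"
    unfolding S_def
    by (intro compact_op_add[OF compact_op_add compact_op_diff] compact_op_scaleR K(1)
        compact_op_compose_left[OF Kp(1) K(1)] compact_op_compose_left[OF Fp(1) \<open>compact_op F\<close>] \<open>compact_op F\<close>)
  have sS: "selfadjoint_op S"
    using cS unfolding selfadjoint_op_iff
    by (simp add: compact_op_def S_def inner_add_left inner_add_right inner_diff_left inner_diff_right
        Kp(3) Fp(3))
  have bS: "bounded_clinear S"
    using cS by (simp add: compact_op_def)
  have two: "(2 * \<alpha>) *\<^sub>R v = \<alpha> *\<^sub>R v + \<alpha> *\<^sub>R v" for v :: 'a
    by (simp flip: scaleR_add_left)
  have TT: "T (T x) = S x + \<alpha>\<^sup>2 *\<^sub>R x" for x
  proof -
    have "T (T x) = (K (K x) + \<alpha> *\<^sub>R K x) - (\<alpha> *\<^sub>R F x - F (F x)) + \<alpha> *\<^sub>R (K x - F x + \<alpha> *\<^sub>R x)"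
      unfolding T by (simp add: lin KF FK)
    also have "\<dots> = S x + \<alpha>\<^sup>2 *\<^sub>R x"
      by (simp add: S_def two power2_eq_square scaleR_add_right scaleR_diff_right)
    finally show ?thesis .
  qed
  \<comment> \<open>On unit vectors the squared norm of T x and the form of S differ by the constant
    \<alpha>^2, so they have the same maximisers.\<close>
  have norm_T: "(norm (T x))\<^sup>2 = S x \<bullet> x + \<alpha>\<^sup>2 * (norm x)\<^sup>2" for x
  proof -
    have "(norm (T x))\<^sup>2 = T (T x) \<bullet> x"
      by (simp add: power2_norm_eq_inner Tp(3)[of "T x" x])
    also have "\<dots> = S x \<bullet> x + \<alpha>\<^sup>2 * (norm x)\<^sup>2"
      by (simp add: TT inner_add_left power2_norm_eq_inner)
    finally show ?thesis .
  qed
  have "norm_attaining_on M T" if M: "csubspace M" "closed M" "M \<noteq> {0}" for M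
  proof -
    have sM: "subspace M"
      by (rule csubspace_subspace[OF M(1)])
    have normalize: "inverse (norm x) *\<^sub>R x \<in> M" "norm (inverse (norm x) *\<^sub>R x) = 1"
      if "x \<in> M" "x \<noteq> 0" for x
      using that sM by (auto simp: subspace_scale)
    have "\<exists>x\<in>M. norm x = 1 \<and> (\<forall>y\<in>M. S y \<bullet> y \<le> (S x \<bullet> x) * (norm y)\<^sup>2)"
    proof (cases "\<exists>x0\<in>M. S x0 \<bullet> x0 > 0")
      case True
      then show ?thesis
        using compact_form_attains_sup[OF cS sS sM M(2)] by metis
    next
      case nonpos: False
      show ?thesis
      proof (cases "\<exists>x\<in>M. x \<noteq> 0 \<and> F x = 0")
        case True
        then obtain x where x: "x \<in> M" "norm x = 1" "F x = 0"
          using normalize by (metis lin(12) scaleR_zero_right)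
        have "S x \<bullet> x = K x \<bullet> K x + 2 * \<alpha> * (K x \<bullet> x)"
          by (simp add: S_def x(3) lin inner_add_left Kp(3)[of "K x" x])
        then have "S x \<bullet> x \<ge> 0"
          using Kp(4)[of x] \<open>\<alpha> \<ge> 0\<close> by simp
        moreover have "S y \<bullet> y \<le> 0" if "y \<in> M" for y
          using nonpos that by (meson not_le)
        ultimately show ?thesis
          using x(1,2) by (meson mult_nonneg_nonneg order_trans zero_le_power2)
      next
        case False
        then have "cfinite_dim M"
          using cfinite_dim_if_inj_on[OF F(1) M(1)] by blast
        then obtain C where C: "compact C" "M \<inter> cball 0 1 \<subseteq> C"
          by (rule cfinite_dim_bounded_in_compact)
        have "closed (sphere (0::'a) 1)"
          unfolding sphere_def by (intro closed_Collect_eq continuous_intros)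
        then have "compact (C \<inter> (M \<inter> sphere 0 1))"
          using C(1) M(2) by (intro compact_Int_closed closed_Int)
        moreover have "C \<inter> (M \<inter> sphere 0 1) = M \<inter> sphere 0 1"
          using C(2) by auto
        ultimately have "compact (M \<inter> sphere 0 1)"
          by simp
        moreover have "M \<inter> sphere 0 1 \<noteq> {}"
          using normalize M(3) complex_vector.subspace_0[OF M(1)] by fastforce
        moreover have "continuous_on (M \<inter> sphere 0 1) (\<lambda>x. S x \<bullet> x)"
          by (intro continuous_on_inner continuous_on_id linear_continuous_on bounded_clinearD(1)[OF bS])
        ultimately obtain x where x: "x \<in> M \<inter> sphere 0 1"
            "\<And>y. y \<in> M \<inter> sphere 0 1 \<Longrightarrow> S y \<bullet> y \<le> S x \<bullet> x"
          using continuous_attains_sup[of "M \<inter> sphere 0 1" "\<lambda>x. S x \<bullet> x"] by blast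
        have "S y \<bullet> y \<le> (S x \<bullet> x) * (norm y)\<^sup>2" if "y \<in> M" for y
        proof (cases "y = 0")
          case False
          have "S (inverse (norm y) *\<^sub>R y) \<bullet> (inverse (norm y) *\<^sub>R y) \<le> S x \<bullet> x"
            using normalize[OF that False] by (intro x(2)) auto
          then show ?thesis
            using False by (simp add: bounded_clinearD[OF bS] field_simps power2_eq_square)
        qed (simp add: bounded_clinearD[OF bS])
        then show ?thesis
          using x(1) by auto
      qed
    qed
    then obtain x where x: "x \<in> M" "norm x = 1" "\<And>y. y \<in> M \<Longrightarrow> S y \<bullet> y \<le> (S x \<bullet> x) * (norm y)\<^sup>2"
      by blast
    have "norm (T y) \<le> norm (T x) * norm y" if "y \<in> M" for y
    proof (rule power2_le_imp_le)
      show "(norm (T y))\<^sup>2 \<le> (norm (T x) * norm y)\<^sup>2"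
        using x(3)[OF that] by (simp add: power_mult_distrib norm_T x(2) distrib_right)
    qed simp
    then show ?thesis
      using norm_attaining_on_iff[OF bounded_clinearD(1)[OF Tp(1)] sM] x(1,2) by blast
  qed
  then show ?thesis
    using Tp(1) by (simp add: abs_norm_attaining_def)
qed

text \<open>For \<open>B = K + F\<close> and \<open>B' = K' + F'\<close> one has \<open>\<parallel>B v\<parallel> = \<parallel>(K - F) v\<parallel> = \<parallel>B' v\<parallel>\<close>, that is,
  \<open>\<langle>(B - B') v, (B + B') v\<rangle> = 0\<close>. As \<open>B - B' = 2 (F - F')\<close>, an eigenvector \<open>v\<close> of \<open>F - F'\<close> with
  nonzero eigenvalue would be annihilated by the positive operator \<open>B + B'\<close>.\<close>

lemma positive_parts_unique:
  assumes K: "positive_op K" "positive_op K'" and F: "positive_op F" "positive_op F'"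
    and cF: "compact_op F" "compact_op F'"
    and KF: "\<And>x. K (F x) = 0" "\<And>x. K' (F' x) = 0"
    and eq: "\<And>x. K x - F x = K' x - F' x"
  shows "F x = F' x"
proof (rule ccontr)
  assume "F x \<noteq> F' x"
  define D where "D = (\<lambda>x. F x - F' x)"
  have cD: "compact_op D"
    unfolding D_def by (rule compact_op_diff[OF cF])
  then have "selfadjoint_op D"
    unfolding selfadjoint_op_iff compact_op_def
    by (auto simp: D_def inner_diff_left inner_diff_right positive_opD(3)[OF F(1)] positive_opD(3)[OF F(2)])
  then obtain c v where v: "c \<noteq> 0" "v \<noteq> 0" "D v = c *\<^sub>R v"
    using compact_selfadjoint_eigenvector[OF cD, of x] \<open>F x \<noteq> F' x\<close> by (auto simp: D_def)
  \<comment> \<open>The mixed terms are inner products of K v with F v, which vanish by symmetry of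
    K and KF = 0.\<close>
  have norm_sq: "(K v + F v) \<bullet> (K v + F v) = (K v - F v) \<bullet> (K v - F v)"
    if "positive_op K" "\<And>x. K (F x) = 0" for K F :: "'a \<Rightarrow> 'a"
    using positive_opD(3)[OF that(1), of v "F v"] that(2)
    by (simp add: inner_add_left inner_add_right inner_diff_left inner_diff_right inner_commute[of "F v" "K v"])
  have "(K v + F v) \<bullet> (K v + F v) = (K' v + F' v) \<bullet> (K' v + F' v)"
    using norm_sq[of K F, OF K(1) KF(1)] norm_sq[of K' F', OF K(2) KF(2)] by (simp only: eq)
  moreover have "(x - y) \<bullet> (x + y) = x \<bullet> x - y \<bullet> y" for x y :: 'a
    by (simp add: inner_diff_left inner_add_right inner_commute[of y x])
  ultimately have "((K v + F v) - (K' v + F' v)) \<bullet> ((K v + F v) + (K' v + F' v)) = 0"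
    by simp
  moreover have "K v - K' v = F v - F' v"
    using eq[of v] by (simp add: algebra_simps)
  then have "(K v + F v) - (K' v + F' v) = D v + D v"
    by (simp add: D_def add_diff_add)
  then have "(K v + F v) - (K' v + F' v) = (2 * c) *\<^sub>R v"
    by (simp add: v(3) flip: scaleR_add_left)
  ultimately have "v \<bullet> ((K v + F v) + (K' v + F' v)) = 0"
    using v(1) by simp
  then have "K v \<bullet> v + F v \<bullet> v + (K' v \<bullet> v + F' v \<bullet> v) = 0"
    by (simp add: inner_add_right inner_commute)
  then have "F v \<bullet> v = 0" "F' v \<bullet> v = 0"
    using positive_opD(4)[OF K(1), of v] positive_opD(4)[OF K(2), of v]
      positive_opD(4)[OF F(1), of v] positive_opD(4)[OF F(2), of v] by linarith+
  then have "D v = 0"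
    by (simp add: D_def positive_op_kernel[OF F(1)] positive_op_kernel[OF F(2)])
  then show False
    using v by simp
qed

section \<open>Eigenvector sequences\<close>

lemma closed_orthogonal_complement: "closed {x. \<forall>y\<in>Y. cinner x y = 0}"
proof -
  have "closed {x. cinner x y = 0}" for y :: 'a
    by (intro closed_Collect_eq linear_continuous_on bounded_linear_cinner_left continuous_on_const)
  then have "closed (\<Inter>y\<in>Y. {x. cinner x y = 0})"
    by auto
  also have "(\<Inter>y\<in>Y. {x. cinner x y = 0}) = {x. \<forall>y\<in>Y. cinner x y = 0}"
    by auto
  finally show ?thesis .
qed

lemma csubspace_orthogonal_complement: "csubspace {x. \<forall>y\<in>Y. cinner x y = 0}"
  by (rule complex_vector.subspaceI) (auto simp: cinner_add_left cinner_scaleC_left)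

text \<open>Each vector maximises \<open>norm (T x)\<close> on the part of R orthogonal to its
  predecessors. That part is T-invariant because the predecessors are eigenvectors, and nonzero
  because R is infinite-dimensional. The relative version in R is needed because the argument is run
  twice: on the whole space, and on the orthogonal complement of the kernel of F.\<close>

lemma abs_norm_attaining_eigensequence:
  assumes T: "positive_op T" "abs_norm_attaining T"
    and R: "csubspace R" "closed R" "T ` R \<subseteq> R" "\<not> cfinite_dim R"
  obtains e :: "nat \<Rightarrow> 'a::complex_hilbert"
  where "orthonormal UNIV e" "\<And>n. e n \<in> R" "\<And>n. T (e n) = norm (T (e n)) *\<^sub>R e n"
    "\<And>n x. x \<in> R \<Longrightarrow> (\<And>i. i < n \<Longrightarrow> cinner x (e i) = 0) \<Longrightarrow> norm (T x) \<le> norm (T (e n)) * norm x"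
proof -
  note Tp = positive_opD[OF T(1)]
  \<comment> \<open>Only orthogonality to earlier vectors is demanded, so that the choice at n
    depends on f below n alone; full orthonormality follows by conjugate symmetry.\<close>
  define P where "P f n r \<longleftrightarrow> r \<in> R \<and> norm r = 1 \<and> (\<forall>i<n. cinner r (f i) = 0) \<and>
      T r = norm (T r) *\<^sub>R r \<and>
      (\<forall>x\<in>R. (\<forall>i<n. cinner x (f i) = 0) \<longrightarrow> norm (T x) \<le> norm (T r) * norm x)"
    for f :: "nat \<Rightarrow> 'a" and n :: nat and r
  have "\<exists>e. \<forall>n. P e n (e n)"
  proof (rule dependent_wellorder_choice)
    fix r :: 'a and f g :: "nat \<Rightarrow> 'a" and n :: nat
    assume "\<And>i. i < n \<Longrightarrow> f i = g i"
    then show "P f n r = P g n r"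
      by (simp add: P_def)
  next
    fix n :: nat and f :: "nat \<Rightarrow> 'a"
    assume f: "P f i (f i)" if "i < n" for i
    define M where "M = R \<inter> {x. \<forall>y\<in>f ` {..<n}. cinner x y = 0}"
    have M: "csubspace M" "closed M"
      unfolding M_def
      by (rule complex_vector.subspace_inter[OF R(1) csubspace_orthogonal_complement],
          rule closed_Int[OF R(2) closed_orthogonal_complement])
    have orth: "orthonormal {..<n} f"
      unfolding orthonormal_def
    proof (intro ballI)
      fix i j assume "i \<in> {..<n}" "j \<in> {..<n}"
      then show "cinner (f i) (f j) = (if i = j then 1 else 0)"
        using f[of i] f[of j] cinner_commute[of "f i" "f j"] cinner_self[of "f i"]
        by (cases i j rule: linorder_cases) (auto simp: P_def)
    qed
    have "M \<noteq> {0}"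
    proof
      assume "M = {0}"
      \<comment> \<open>The residual of x after projection onto the span of the earlier vectors lies
        in M, hence is zero.\<close>
      have "R \<subseteq> cspan (f ` {..<n})"
      proof
        fix x assume "x \<in> R"
        let ?p = "\<Sum>i<n. cinner x (f i) *\<^sub>C f i"
        have p: "?p \<in> R"
          using f by (intro complex_vector.subspace_sum[OF R(1)] complex_vector.subspace_scale[OF R(1)])
            (auto simp: P_def)
        have "cinner (x - ?p) (f i) = 0" if "i < n" for i
          unfolding cinner_diff_left
          using that by (subst cinner_sum_orthonormal[OF finite_lessThan orth]) auto
        then have "x - ?p \<in> M"
          using complex_vector.subspace_diff[OF R(1) \<open>x \<in> R\<close> p] by (auto simp: M_def)
        then have "x = ?p"
          using \<open>M = {0}\<close> by simp
        moreover have "?p \<in> cspan (f ` {..<n})"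
          by (intro complex_vector.span_sum complex_vector.span_scale complex_vector.span_base) auto
        ultimately show "x \<in> cspan (f ` {..<n})"
          by simp
      qed
      moreover have "cfinite_dim (cspan (f ` {..<n}))"
        by (auto simp: cfinite_dim_def)
      ultimately show False
        using cfinite_dim_subset R(1,4) by blast
    qed
    then have "norm_attaining_on M T"
      using T(2) M by (simp add: abs_norm_attaining_def)
    then obtain r where r: "r \<in> M" "norm r = 1" "\<And>y. y \<in> M \<Longrightarrow> norm (T y) \<le> norm (T r) * norm y"
      using norm_attaining_on_iff[OF bounded_clinearD(1)[OF Tp(1)] csubspace_subspace[OF M(1)]] by blast
    have "T ` M \<subseteq> M"
    proof clarify
      fix x assume x: "x \<in> M"
      have "cinner (T x) (f i) = 0" if "i < n" for i
      proof -
        have "T (f i) = norm (T (f i)) *\<^sub>R f i"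
          using f[OF that] by (simp add: P_def)
        then have "cinner (T x) (f i) = complex_of_real (norm (T (f i))) * cinner x (f i)"
          by (metis selfadjoint_cinner[OF Tp(2)] cinner_scaleR_right)
        then show ?thesis
          using x that by (simp add: M_def)
      qed
      then show "T x \<in> M"
        using x R(3) by (auto simp: M_def)
    qed
    then have "T r = norm (T r) *\<^sub>R r"
      using r by (intro norm_maximizer_eigenvector[OF T(1)])
    then have "P f n r"
      using r by (auto simp: P_def M_def)
    then show "\<exists>r. P f n r" ..
  qed
  then obtain e where e: "\<And>n. P e n (e n)"
    by blast
  show ?thesis
  proof (rule that)
    show "orthonormal UNIV e"
      unfolding orthonormal_def
    proof (intro ballI)
      fix i j :: nat
      show "cinner (e i) (e j) = (if i = j then 1 else 0)"
        using e[of i] e[of j] cinner_commute[of "e i" "e j"] cinner_self[of "e i"]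
        by (cases i j rule: linorder_cases) (auto simp: P_def)
    qed
    show "norm (T x) \<le> norm (T (e n)) * norm x"
      if "x \<in> R" "\<And>i. i < n \<Longrightarrow> cinner x (e i) = 0" for n x
      using e[of n] that by (auto simp: P_def)
  qed (use e in \<open>auto simp: P_def\<close>)
qed

text \<open>The identity is positive and attains its norm on every nonzero subspace, so the
  eigenvector construction applied to it already yields an orthonormal sequence.\<close>

lemma orthonormal_sequence_exists:
  assumes "\<not> cfinite_dim (UNIV :: 'a::complex_hilbert set)"
  obtains e :: "nat \<Rightarrow> 'a::complex_hilbert" where "orthonormal UNIV e"
proof -
  have "positive_op (\<lambda>x::'a. x)"
    by (simp add: positive_op_iff bounded_clinear_id)
  moreover have "norm_attaining_on M (\<lambda>x::'a. x)" if M: "csubspace M" "M \<noteq> {0}" for M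
  proof -
    obtain x where "x \<in> M" "x \<noteq> 0"
      using M complex_vector.subspace_0[OF M(1)] by blast
    then have "inverse (norm x) *\<^sub>R x \<in> M \<and> norm (inverse (norm x) *\<^sub>R x) = 1"
      using csubspace_subspace[OF M(1)] by (simp add: subspace_scale)
    then show ?thesis
      by (subst norm_attaining_on_iff[OF bounded_linear_ident csubspace_subspace[OF M(1)]]) force
  qed
  then have "abs_norm_attaining (\<lambda>x::'a. x)"
    by (simp add: abs_norm_attaining_def bounded_clinear_id)
  ultimately show ?thesis
    by (rule abs_norm_attaining_eigensequence[of "\<lambda>x::'a. x" UNIV]) (use assms that in auto)
qed

text \<open>Distinct orthonormal vectors have distance sqrt 2, so no subsequence of their multiples
  by c \<noteq> 0 is Cauchy. This determines \<alpha> in the decomposition.\<close>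

lemma compact_scalar_zero:
  assumes "\<not> cfinite_dim (UNIV :: 'a::complex_hilbert set)" "compact_op (\<lambda>x::'a. c *\<^sub>R x)"
  shows "c = 0"
proof (rule ccontr)
  assume "c \<noteq> 0"
  obtain e :: "nat \<Rightarrow> 'a" where e: "orthonormal UNIV e"
    using orthonormal_sequence_exists[OF assms(1)] .
  obtain r l where r: "strict_mono (r :: nat \<Rightarrow> nat)" "(\<lambda>n. c *\<^sub>R e (r n)) \<longlonglongrightarrow> l"
    using compact_op_convergent_subseq[OF assms(2), of e] orthonormal_norm[OF e] by auto
  obtain N where N: "\<And>m n. m \<ge> N \<Longrightarrow> n \<ge> N \<Longrightarrow> dist (c *\<^sub>R e (r m)) (c *\<^sub>R e (r n)) < \<bar>c\<bar>"
    using metric_CauchyD[OF LIMSEQ_imp_Cauchy[OF r(2)], of "\<bar>c\<bar>"] \<open>c \<noteq> 0\<close> by auto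
  define i j where "i = r N" and "j = r (Suc N)"
  have "i \<noteq> j"
    using strict_monoD[OF r(1), of N "Suc N"] by (simp add: i_def j_def)
  then have "e i \<bullet> e j = 0" "e i \<bullet> e i = 1" "e j \<bullet> e j = 1"
    using e by (auto simp: inner_eq_Re_cinner orthonormal_def)
  then have "(norm (e i - e j))\<^sup>2 = 2"
    unfolding power2_norm_eq_inner by (simp add: inner_diff_left inner_diff_right inner_commute[of "e j" "e i"])
  then have "norm (e i - e j) \<ge> 1"
    by (metis one_le_numeral one_power2 power2_le_imp_le norm_ge_zero)
  moreover have "\<bar>c\<bar> * norm (e i - e j) < \<bar>c\<bar>"
    using N[of N "Suc N"] by (simp add: dist_norm i_def j_def flip: scaleR_diff_right)
  ultimately show False
    using \<open>c \<noteq> 0\<close> by simp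
qed

lemma decomposition_unique:
  fixes K :: "'a::complex_hilbert \<Rightarrow> 'a"
  assumes dim: "\<not> cfinite_dim (UNIV :: 'a set)"
    and K: "positive_op K" "positive_op K'" "compact_op K" "compact_op K'"
    and F: "positive_op F" "positive_op F'" "compact_op F" "compact_op F'"
    and KF: "\<And>x. K (F x) = 0" "\<And>x. K' (F' x) = 0"
    and eq: "\<And>x. K x - F x + \<alpha> *\<^sub>R x = K' x - F' x + \<alpha>' *\<^sub>R x"
  shows "K = K' \<and> F = F' \<and> \<alpha> = \<alpha>'"
proof -
  have "(K' x - F' x) - (K x - F x) = (\<alpha> - \<alpha>') *\<^sub>R x" for x
    using eq[of x] by (simp add: algebra_simps)
  moreover have "compact_op (\<lambda>x. (K' x - F' x) - (K x - F x))"
    by (intro compact_op_diff K F)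
  ultimately have "\<alpha> = \<alpha>'"
    using compact_scalar_zero[OF dim, of "\<alpha> - \<alpha>'"] by simp
  then have KF_eq: "K x - F x = K' x - F' x" for x
    using eq[of x] by simp
  then have "F = F'"
    using positive_parts_unique[OF K(1,2) F KF] by blast
  then show ?thesis
    using KF_eq \<open>\<alpha> = \<alpha>'\<close> by auto
qed

section \<open>Diagonal operators\<close>

text \<open>Monotonicity together with the limit 0 makes the d i nonnegative. The convergence of the
  partial sums is part of the conclusion because the bounds on F and the identity KF = 0 are later
  checked on these sums.\<close>

lemma diagonal_operator:
  fixes e :: "nat \<Rightarrow> 'a::complex_hilbert" and d :: "nat \<Rightarrow> real"
  assumes e: "orthonormal UNIV e" and d: "decseq d" "d \<longlonglongrightarrow> 0"
  obtains K where "compact_op K" "positive_op K" "\<And>j. K (e j) = d j *\<^sub>R e j"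
    "\<And>x. (\<lambda>n. \<Sum>i<n. (complex_of_real (d i) * cinner x (e i)) *\<^sub>C e i) \<longlonglongrightarrow> K x"
proof -
  define f where "f x i = (complex_of_real (d i) * cinner x (e i)) *\<^sub>C e i" for x i
  define P where "P n x = (\<Sum>i<n. f x i)" for n x
  define K where "K x = (\<Sum>i. f x i)" for x
  have d0: "d i \<ge> 0" for i
    using decseq_ge[OF d] .
  have on: "orthonormal I e" for I
    using orthonormal_subset[OF e] by blast
  \<comment> \<open>By Bessel and monotonicity of d. This estimate gives both convergence of the
    series and, being uniform on the unit ball, approximation of K in operator norm by finite rank
    operators.\<close>
  have tail: "norm (\<Sum>i\<in>{m..<n}. f x i) \<le> d m * norm x" for m n x
  proof (rule power2_le_imp_le)
    have "(norm (\<Sum>i\<in>{m..<n}. f x i))\<^sup>2 = (\<Sum>i\<in>{m..<n}. (d i)\<^sup>2 * (cmod (cinner x (e i)))\<^sup>2)"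
      unfolding f_def by (subst norm_sum_orthonormal) (auto simp: on norm_mult power_mult_distrib)
    also have "\<dots> \<le> (\<Sum>i\<in>{m..<n}. (d m)\<^sup>2 * (cmod (cinner x (e i)))\<^sup>2)"
      using d0 decseqD[OF d(1)] by (intro sum_mono mult_right_mono power_mono) auto
    also have "\<dots> = (d m)\<^sup>2 * (\<Sum>i\<in>{m..<n}. (cmod (cinner x (e i)))\<^sup>2)"
      by (simp add: sum_distrib_left)
    also have "\<dots> \<le> (d m)\<^sup>2 * (norm x)\<^sup>2"
      by (intro mult_left_mono bessel_inequality on) auto
    finally show "(norm (\<Sum>i\<in>{m..<n}. f x i))\<^sup>2 \<le> (d m * norm x)\<^sup>2"
      by (simp add: power_mult_distrib)
  qed (simp add: d0)
  have summ: "summable (f x)" for x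
  proof (rule summable_Cauchy'[where g = "\<lambda>m. d m * norm x"])
    show "(\<lambda>m. d m * norm x) \<longlonglongrightarrow> 0"
      using tendsto_mult_left_zero[OF d(2)] .
  qed (simp add: tail)
  have lim: "(\<lambda>n. P n x) \<longlonglongrightarrow> K x" for x
    unfolding P_def K_def by (rule summable_LIMSEQ[OF summ])
  have err: "norm (K x - P m x) \<le> d m * norm x" for m x
  proof (rule Lim_bounded)
    show "(\<lambda>n. norm (P n x - P m x)) \<longlonglongrightarrow> norm (K x - P m x)"
      by (intro tendsto_intros lim)
    show "\<forall>n\<ge>m. norm (P n x - P m x) \<le> d m * norm x"
    proof (intro allI impI)
      fix n assume "m \<le> n"
      then have "P n x - P m x = (\<Sum>i\<in>{m..<n}. f x i)"
        using sum_diff_nat_ivl[of 0 m n "f x"] by (simp add: P_def lessThan_atLeast0)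
      then show "norm (P n x - P m x) \<le> d m * norm x"
        by (simp add: tail)
    qed
  qed
  have P_add: "P n (x + y) = P n x + P n y" for n x y
    by (simp add: P_def f_def cinner_add_left distrib_left scaleC_add_left sum.distrib)
  have P_scaleC: "P n (c *\<^sub>C x) = c *\<^sub>C P n x" for n c x
    by (simp add: P_def f_def cinner_scaleC_left complex_vector.scale_sum_right scaleC_scaleC
        mult.left_commute)
  have P_bound: "norm (P n x) \<le> norm x * d 0" for n x
    using tail[of x 0 n] by (simp add: P_def lessThan_atLeast0 mult.commute)
  have P_bclinear: "bounded_clinear (P n)" for n
    by (rule bounded_clinear_intro[OF P_add P_scaleC P_bound])
  have K_bclinear: "bounded_clinear K"
  proof (rule bounded_clinear_intro)
    show "K (x + y) = K x + K y" for x y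
      using LIMSEQ_unique[OF lim[of "x + y"], of "K x + K y"] tendsto_add[OF lim[of x] lim[of y]]
      by (simp add: P_add)
    show "K (c *\<^sub>C x) = c *\<^sub>C K x" for c x
      using LIMSEQ_unique[OF lim[of "c *\<^sub>C x"], of "c *\<^sub>C K x"]
        bounded_linear.tendsto[OF bounded_linear_scaleC_right[of c] lim[of x]] by (simp add: P_scaleC)
    show "norm (K x) \<le> norm x * d 0" for x
      using err[of x 0] by (simp add: P_def mult.commute)
  qed
  have P_compact: "compact_op (P n)" for n
  proof -
    have "P n x \<in> cspan (e ` {..<n})" for x
      unfolding P_def f_def
      by (intro complex_vector.span_sum complex_vector.span_scale complex_vector.span_base) auto
    then have "range (P n) \<subseteq> cspan (e ` {..<n})"
      by blast
    moreover have "cfinite_dim (cspan (e ` {..<n}))"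
      by (auto simp: cfinite_dim_def)
    ultimately have "finite_rank_op (P n)"
      using cfinite_dim_subset[OF csubspace_range[OF P_bclinear]] P_bclinear
      by (simp add: finite_rank_op_def)
    then show ?thesis
      by (rule finite_rank_compact)
  qed
  have P_cinner: "cinner (P n x) y = (\<Sum>i<n. complex_of_real (d i) * (cinner x (e i) * cnj (cinner y (e i))))"
    for n x y
    by (simp add: P_def f_def cinner_sum_left cinner_scaleC_left cinner_commute[of "e _" y] mult.assoc)
  have P_sym: "P n x \<bullet> y = x \<bullet> P n y" for n x y
  proof -
    have "cinner x (P n y) = cnj (cinner (P n y) x)"
      by (rule cinner_commute)
    also have "\<dots> = cinner (P n x) y"
      by (simp add: P_cinner mult.commute)
    finally show ?thesis
      by (simp add: inner_eq_Re_cinner)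
  qed
  have P_pos: "P n x \<bullet> x \<ge> 0" for n x
  proof -
    have "P n x \<bullet> x = (\<Sum>i<n. d i * (cmod (cinner x (e i)))\<^sup>2)"
      by (simp only: inner_eq_Re_cinner P_cinner complex_norm_square[symmetric] Re_sum
          Re_complex_of_real flip: of_real_mult)
    then show ?thesis
      by (simp add: sum_nonneg d0)
  qed
  show ?thesis
  proof (rule that)
    show "compact_op K"
    proof (rule compact_op_uniform_limit[OF K_bclinear])
      fix \<epsilon> :: real assume "\<epsilon> > 0"
      then obtain m where "d m < \<epsilon>"
        using order_tendstoD(2)[OF d(2)] eventually_happens by (metis sequentially_bot)
      have "norm (K x - P m x) \<le> \<epsilon>" if "norm x \<le> 1" for x
        using err[of x m] mult_left_mono[OF that d0[of m]] \<open>d m < \<epsilon>\<close> by simp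
      then show "\<exists>S. compact_op S \<and> (\<forall>x. norm x \<le> 1 \<longrightarrow> norm (K x - S x) \<le> \<epsilon>)"
        using P_compact by blast
    qed
    have "K x \<bullet> y = x \<bullet> K y" for x y
    proof (rule LIMSEQ_unique)
      show "(\<lambda>n. P n x \<bullet> y) \<longlonglongrightarrow> K x \<bullet> y"
        by (intro tendsto_inner tendsto_const lim)
      show "(\<lambda>n. P n x \<bullet> y) \<longlonglongrightarrow> x \<bullet> K y"
        unfolding P_sym by (intro tendsto_inner tendsto_const lim)
    qed
    moreover have "K x \<bullet> x \<ge> 0" for x
    proof (rule LIMSEQ_le_const)
      show "(\<lambda>n. P n x \<bullet> x) \<longlonglongrightarrow> K x \<bullet> x"
        by (intro tendsto_inner tendsto_const lim)
    qed (use P_pos in blast)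
    ultimately show "positive_op K"
      using K_bclinear by (simp add: positive_op_iff)
    show "K (e j) = d j *\<^sub>R e j" for j
    proof (rule LIMSEQ_unique[OF lim])
      have "P n (e j) = d j *\<^sub>R e j" if "n > j" for n
      proof -
        have "P n (e j) = (\<Sum>i<n. if i = j then d j *\<^sub>R e j else 0)"
          unfolding P_def f_def using e
          by (intro sum.cong) (auto simp: orthonormal_def scaleR_eq_scaleC)
        then show ?thesis
          using that by simp
      qed
      then show "(\<lambda>n. P n (e j)) \<longlonglongrightarrow> d j *\<^sub>R e j"
        by (intro tendsto_eventually eventually_sequentiallyI[of "Suc j"]) auto
    qed
    show "(\<lambda>n. \<Sum>i<n. (complex_of_real (d i) * cinner x (e i)) *\<^sub>C e i) \<longlonglongrightarrow> K x" for x
      using lim[of x] by (simp add: P_def f_def)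
  qed
qed

section \<open>Obstruction to absolute norm attainment\<close>

text \<open>Meant for the images T (g i), which are orthogonal but not normalised.\<close>

lemma norm_sum_orthogonal:
  assumes "finite I" "\<And>i j. i \<in> I \<Longrightarrow> j \<in> I \<Longrightarrow> i \<noteq> j \<Longrightarrow> cinner (v i) (v j) = 0"
  shows "(norm (\<Sum>i\<in>I. c i *\<^sub>C v i))\<^sup>2 = (\<Sum>i\<in>I. (cmod (c i))\<^sup>2 * (norm (v i))\<^sup>2)"
  using assms
proof (induction I)
  case (insert k I)
  have "cinner (v k) (v i) = 0" if "i \<in> I" for i
    using insert.prems[of k i] insert.hyps that by auto
  then have "cinner (c k *\<^sub>C v k) (\<Sum>i\<in>I. c i *\<^sub>C v i) = 0"
    by (auto simp: cinner_sum_right cinner_scaleC_left cinner_scaleC_right intro!: sum.neutral)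
  then have "orthogonal (c k *\<^sub>C v k) (\<Sum>i\<in>I. c i *\<^sub>C v i)"
    by (simp add: orthogonal_def inner_eq_Re_cinner)
  then show ?case
    using insert by (simp add: norm_add_Pythagorean norm_scaleC power_mult_distrib)
qed simp

text \<open>On the closed span \<open>M\<close> of the \<open>g n\<close> the norm of \<open>T\<close> is \<open>C\<close>, but \<open>\<parallel>T y\<parallel> = C \<parallel>y\<parallel>\<close> forces
  \<open>y\<close> to be orthogonal to every \<open>g k\<close>.\<close>

lemma increasing_norms_not_abs_norm_attaining:
  fixes g :: "nat \<Rightarrow> 'a::complex_hilbert"
  assumes T: "bounded_clinear T" and g: "orthonormal UNIV g"
    and Tg: "\<And>i j. i \<noteq> j \<Longrightarrow> cinner (T (g i)) (T (g j)) = 0"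
    and less: "\<And>n. norm (T (g n)) < C" and lim: "(\<lambda>n. norm (T (g n))) \<longlonglongrightarrow> C"
  shows "\<not> abs_norm_attaining T"
proof
  assume AN: "abs_norm_attaining T"
  define M where "M = closure (cspan (range g))"
  have gM: "g n \<in> M" for n
    unfolding M_def by (intro closure_subset[THEN subsetD] complex_vector.span_base) auto
  have M: "csubspace M" "closed M"
    unfolding M_def by (auto intro: csubspace_closure)
  have "norm (g 0) = 1"
    by (rule orthonormal_norm[OF g]) simp
  then have "g 0 \<noteq> 0"
    by auto
  then have "M \<noteq> {0}"
    using gM[of 0] by auto
  then obtain x where x: "x \<in> M" "norm x = 1" "\<And>y. y \<in> M \<Longrightarrow> norm (T y) \<le> norm (T x) * norm y"
    using AN M norm_attaining_on_iff[OF bounded_clinearD(1)[OF T] csubspace_subspace[OF M(1)]]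
    by (auto simp: abs_norm_attaining_def)
  have "norm (T (g n)) \<le> norm (T x)" for n
    using x(3)[OF gM, of n] orthonormal_norm[OF g, of n] by simp
  then have C: "C \<le> norm (T x)"
    by (intro LIMSEQ_le_const2[OF lim]) auto
  have pos: "C\<^sup>2 - (norm (T (g k)))\<^sup>2 > 0" for k
    using power_strict_mono[OF less[of k], of 2] by simp
  \<comment> \<open>For a finite combination y with coefficients c i, the difference of C^2 times
    the squared norm of y and the squared norm of T y is a sum of nonnegative terms. Keeping only
    the k-th term leaves a condition that is closed in y, so it passes from the span to M.\<close>
  have ineq: "(norm (T y))\<^sup>2 + (C\<^sup>2 - (norm (T (g k)))\<^sup>2) * (cmod (cinner y (g k)))\<^sup>2 \<le> C\<^sup>2 * (norm y)\<^sup>2"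
    if "y \<in> M" for y k
  proof -
    let ?Q = "{y. (norm (T y))\<^sup>2 + (C\<^sup>2 - (norm (T (g k)))\<^sup>2) * (cmod (cinner y (g k)))\<^sup>2 \<le> C\<^sup>2 * (norm y)\<^sup>2}"
    have "cspan (range g) \<subseteq> ?Q"
    proof
      fix y assume "y \<in> cspan (range g)"
      then have "\<exists>n. y \<in> cspan (g ` {..<n})"
      proof (induction rule: complex_vector.span_induct_alt)
        case base
        show ?case
          by (simp add: complex_vector.span_zero)
      next
        case (step c x y)
        then obtain j n where j: "x = g j" and n: "y \<in> cspan (g ` {..<n})"
          by blast
        have "g ` {..<n} \<subseteq> g ` {..<max n (Suc j)}"
          by (intro image_mono) auto
        then have "y \<in> cspan (g ` {..<max n (Suc j)})"
          using n complex_vector.span_mono by blast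
        moreover have "x \<in> cspan (g ` {..<max n (Suc j)})"
          by (intro complex_vector.span_base) (auto simp: j)
        ultimately show ?case
          by (blast intro: complex_vector.span_add complex_vector.span_scale)
      qed
      then obtain n where "y \<in> cspan (g ` {..<n})" ..
      \<comment> \<open>N exceeds k so that the k-th term occurs in the sum, possibly with
        coefficient 0.\<close>
      moreover define N where "N = max n (Suc k)"
      have "g ` {..<n} \<subseteq> g ` {..<N}"
        by (intro image_mono) (auto simp: N_def)
      ultimately have yN: "y \<in> cspan (g ` {..<N})"
        using complex_vector.span_mono by blast
      have on: "orthonormal {..<N} g"
        using orthonormal_subset[OF g] by blast
      define c where "c i = cinner y (g i)" for i
      have y: "y = (\<Sum>i<N. c i *\<^sub>C g i)"
        unfolding c_def by (rule span_orthonormal_expansion[OF finite_lessThan on yN])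
      have Ty: "T y = (\<Sum>i<N. c i *\<^sub>C T (g i))"
        by (subst y) (simp add: bounded_clinearD[OF T])
      have "(C\<^sup>2 - (norm (T (g k)))\<^sup>2) * (cmod (c k))\<^sup>2 \<le> (\<Sum>i<N. (C\<^sup>2 - (norm (T (g i)))\<^sup>2) * (cmod (c i))\<^sup>2)"
        by (rule member_le_sum) (use pos in \<open>auto simp: N_def less_imp_le\<close>)
      also have "\<dots> = C\<^sup>2 * (\<Sum>i<N. (cmod (c i))\<^sup>2) - (\<Sum>i<N. (cmod (c i))\<^sup>2 * (norm (T (g i)))\<^sup>2)"
        by (simp add: sum_distrib_left left_diff_distrib sum_subtractf mult.commute[of "(cmod _)\<^sup>2"])
      also have "\<dots> = C\<^sup>2 * (norm y)\<^sup>2 - (norm (T y))\<^sup>2"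
        unfolding Ty using Tg
        by (subst norm_sum_orthogonal) (auto simp: y norm_sum_orthonormal[OF finite_lessThan on])
      finally show "y \<in> ?Q"
        by (simp add: c_def)
    qed
    moreover have "closed ?Q"
      by (intro closed_Collect_le continuous_intros
          linear_continuous_on[OF bounded_clinearD(1)[OF T]]
          linear_continuous_on[OF bounded_linear_cinner_left])
    ultimately show ?thesis
      using that closure_minimal unfolding M_def by blast
  qed
  have "cinner x (g k) = 0" for k
  proof -
    have "0 \<le> C"
      using less[of 0] norm_ge_zero[of "T (g 0)"] by linarith
    then have "C\<^sup>2 \<le> (norm (T x))\<^sup>2"
      by (intro power_mono C)
    then have "(C\<^sup>2 - (norm (T (g k)))\<^sup>2) * (cmod (cinner x (g k)))\<^sup>2 \<le> 0"
      using ineq[OF x(1), of k] x(2) by simp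
    then show ?thesis
      using pos[of k] by (simp add: mult_le_0_iff)
  qed
  \<comment> \<open>Orthogonality to every g k extends to the closed span M, which contains x
    itself.\<close>
  then have "range g \<subseteq> {y. \<forall>z\<in>{x}. cinner y z = 0}"
    using cinner_commute[of _ x] by auto
  then have "cspan (range g) \<subseteq> {y. \<forall>z\<in>{x}. cinner y z = 0}"
    by (intro complex_vector.span_minimal csubspace_orthogonal_complement)
  then have "M \<subseteq> {y. \<forall>z\<in>{x}. cinner y z = 0}"
    unfolding M_def by (intro closure_minimal closed_orthogonal_complement)
  then have "cinner x x = 0"
    using x(1) by auto
  then show False
    using x(2) by (simp add: cinner_self)
qed

section \<open>The structure theorem\<close>

text \<open>If \<open>F\<close> had infinite rank, then \<open>T\<close> would have orthonormal eigenvectors \<open>f n\<close> with eigenvalues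
  bounded by some \<open>\<mu> 0 < \<alpha>\<close>, orthogonal to the \<open>e n\<close>, whose eigenvalues are at least \<open>\<alpha>\<close>. Suitable
  combinations \<open>g n = a n e n + b n f n\<close> then have \<open>\<parallel>T (g n)\<parallel>\<close> strictly increasing to \<open>\<alpha>\<close>.\<close>

lemma decomposition_finite_rank:
  fixes e :: "nat \<Rightarrow> 'a::complex_hilbert"
  assumes T: "positive_op T" "abs_norm_attaining T"
    and e: "orthonormal UNIV e" "\<And>n. T (e n) = l n *\<^sub>R e n" "\<And>n. \<alpha> \<le> l n" "\<And>n. F (e n) = 0"
    and K: "positive_op K" and F: "positive_op F" and KF: "\<And>x. K (F x) = 0"
    and T_eq: "\<And>x. T x = K x - F x + \<alpha> *\<^sub>R x"
  shows "finite_rank_op F"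
proof (rule ccontr)
  assume not_fr: "\<not> finite_rank_op F"
  note Tp = positive_opD[OF T(1)] and Kp = positive_opD[OF K] and Fp = positive_opD[OF F]
  have FK: "F (K x) = 0" for x
    using selfadjoint_compose_zero_commute[OF Kp(2) Fp(2) KF] .
  \<comment> \<open>The orthogonal complement of the kernel of F: it contains the range of F, so it
    is infinite-dimensional here; it is orthogonal to the e n; and T leaves it invariant because T
    preserves the kernel.\<close>
  define R where "R = {x. \<forall>y\<in>{y. F y = 0}. cinner x y = 0}"
  have R: "csubspace R" "closed R"
    unfolding R_def by (rule csubspace_orthogonal_complement, rule closed_orthogonal_complement)
  have orthR: "cinner x y = 0" if "x \<in> R" "F y = 0" for x y
    using that by (simp add: R_def)
  have "T ` R \<subseteq> R"
  proof clarify
    fix x assume "x \<in> R"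
    have "cinner (T x) y = 0" if "F y = 0" for y
    proof -
      have "F (T y) = 0"
        using that by (simp add: T_eq bounded_clinearD[OF Fp(1)] FK)
      then show ?thesis
        using orthR[OF \<open>x \<in> R\<close>] by (simp add: selfadjoint_cinner[OF Tp(2)])
    qed
    then show "T x \<in> R"
      by (simp add: R_def)
  qed
  have "range F \<subseteq> R"
    by (auto simp: R_def selfadjoint_cinner[OF Fp(2)])
  then have "\<not> cfinite_dim R"
    using cfinite_dim_subset[OF csubspace_range[OF Fp(1)]] not_fr Fp(1) by (auto simp: finite_rank_op_def)
  then obtain f :: "nat \<Rightarrow> 'a" where f: "orthonormal UNIV f" "\<And>n. f n \<in> R"
      "\<And>n. T (f n) = norm (T (f n)) *\<^sub>R f n"
      "\<And>n x. x \<in> R \<Longrightarrow> (\<And>i. i < n \<Longrightarrow> cinner x (f i) = 0) \<Longrightarrow> norm (T x) \<le> norm (T (f n)) * norm x"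
    using abs_norm_attaining_eigensequence[OF T R \<open>T ` R \<subseteq> R\<close>] by metis
  define \<mu> where "\<mu> n = norm (T (f n))" for n
  have Tf: "T (f n) = \<mu> n *\<^sub>R f n" for n
    using f(3) by (simp add: \<mu>_def)
  have \<mu>0: "0 \<le> \<mu> n" "\<mu> n \<le> \<mu> 0" for n
    using f(4)[OF f(2), of 0 n] orthonormal_norm[OF f(1), of n] by (auto simp: \<mu>_def)
  \<comment> \<open>The range of K lies in the kernel of F, so it is orthogonal to f 0 and K (f 0) =
    0. Thus f 0 is an eigenvector of F for \<alpha> - \<mu> 0, which is nonnegative since F is
    positive, and nonzero since f 0 is a unit vector orthogonal to the kernel.\<close>
  have "\<mu> 0 < \<alpha>"
  proof -
    have "K (f 0) \<bullet> K (f 0) = f 0 \<bullet> K (K (f 0))"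
      by (rule Kp(3))
    also have "\<dots> = 0"
      using orthR[OF f(2) FK] by (simp add: inner_eq_Re_cinner)
    finally have "F (f 0) = (\<alpha> - \<mu> 0) *\<^sub>R f 0"
      using T_eq[of "f 0"] Tf[of 0] by (simp add: algebra_simps)
    moreover have "f 0 \<bullet> f 0 = 1"
      using f(1) by (simp add: inner_eq_Re_cinner orthonormal_def)
    moreover have "F (f 0) \<noteq> 0"
      using orthR[OF f(2), of "f 0" 0] f(1) by (auto simp: orthonormal_def)
    ultimately show ?thesis
      using Fp(4)[of "f 0"] by (cases "\<alpha> = \<mu> 0") auto
  qed
  \<comment> \<open>A positive null sequence; the offset 2 keeps c n = \<alpha> - \<delta> n
    strictly above \<mu> 0 already at n = 0.\<close>
  define \<delta> where "\<delta> = (\<lambda>n. (\<alpha> - \<mu> 0) / real (n + 2))"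
  have \<delta>: "0 < \<delta> n" "\<delta> n < \<alpha> - \<mu> 0" for n
    using \<open>\<mu> 0 < \<alpha>\<close> divide_strict_left_mono[of 1 "real (n + 2)" "\<alpha> - \<mu> 0"]
    by (auto simp: \<delta>_def)
  have "\<delta> \<longlonglongrightarrow> 0"
    unfolding \<delta>_def using LIMSEQ_ignore_initial_segment[OF lim_const_over_n[of "\<alpha> - \<mu> 0"], of 2] by simp
  define c where "c = (\<lambda>n. \<alpha> - \<delta> n)"
  have c: "\<mu> 0 < c n" "c n < \<alpha>" for n
    using \<delta>[of n] by (auto simp: c_def)
  have c_lim: "c \<longlonglongrightarrow> \<alpha>"
    unfolding c_def using tendsto_diff[OF tendsto_const[of \<alpha>] \<open>\<delta> \<longlonglongrightarrow> 0\<close>] by simp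
  \<comment> \<open>The weight solving A l^2 + (1 - A) \<mu>^2 = c^2, which prescribes
    \<open>norm (T (g n)) = c n\<close>. It lies between 0 and 1 because c n lies between \<mu> n
    and l n.\<close>
  define A where "A n = ((c n)\<^sup>2 - (\<mu> n)\<^sup>2) / ((l n)\<^sup>2 - (\<mu> n)\<^sup>2)" for n
  have sq: "(\<mu> n)\<^sup>2 < (c n)\<^sup>2" "(c n)\<^sup>2 < (l n)\<^sup>2" for n
    using \<mu>0[of n] \<mu>0(1)[of 0] c[of n] e(3)[of n] by (auto intro!: power_strict_mono)
  have A: "0 \<le> A n" "A n \<le> 1" for n
    using sq[of n] by (auto simp: A_def)
  have A_eq: "A n * (l n)\<^sup>2 + (1 - A n) * (\<mu> n)\<^sup>2 = (c n)\<^sup>2" for n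
  proof -
    have "A n * (l n)\<^sup>2 + (1 - A n) * (\<mu> n)\<^sup>2 = A n * ((l n)\<^sup>2 - (\<mu> n)\<^sup>2) + (\<mu> n)\<^sup>2"
      by (simp add: algebra_simps)
    then show ?thesis
      using sq[of n] by (simp add: A_def)
  qed
  define g where "g n = sqrt (A n) *\<^sub>R e n + sqrt (1 - A n) *\<^sub>R f n" for n
  have ef: "cinner (e i) (f j) = 0" "cinner (f j) (e i) = 0" for i j
    using orthR[OF f(2) e(4)] cinner_commute[of "e i" "f j"] by auto
  have cinner_comb: "cinner (x *\<^sub>R e i + y *\<^sub>R f i) (x' *\<^sub>R e j + y' *\<^sub>R f j)
      = (if i = j then complex_of_real (x * x' + y * y') else 0)" for x y x' y' i j
    using e(1) f(1) by (simp add: cinner_add_left cinner_add_right cinner_scaleR_left cinner_scaleR_right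
        ef orthonormal_def)
  have Tg: "T (g n) = (sqrt (A n) * l n) *\<^sub>R e n + (sqrt (1 - A n) * \<mu> n) *\<^sub>R f n" for n
    by (simp add: g_def bounded_clinearD[OF Tp(1)] e(2) Tf)
  have "orthonormal UNIV g"
    using A by (auto simp: orthonormal_def g_def cinner_comb)
  moreover have "cinner (T (g i)) (T (g j)) = 0" if "i \<noteq> j" for i j
    using that by (simp add: Tg cinner_comb)
  moreover have norm_Tg: "norm (T (g n)) = c n" for n
  proof -
    have "(sqrt (A n) * l n) * (sqrt (A n) * l n) + (sqrt (1 - A n) * \<mu> n) * (sqrt (1 - A n) * \<mu> n)
        = (sqrt (A n))\<^sup>2 * (l n)\<^sup>2 + (sqrt (1 - A n))\<^sup>2 * (\<mu> n)\<^sup>2"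
      by (simp only: power2_eq_square mult.assoc mult.left_commute)
    also have "\<dots> = (c n)\<^sup>2"
      using A[of n] A_eq[of n] by simp
    finally have "complex_of_real ((norm (T (g n)))\<^sup>2) = complex_of_real ((c n)\<^sup>2)"
      unfolding cinner_self[symmetric] Tg cinner_comb by simp
    then have "(norm (T (g n)))\<^sup>2 = (c n)\<^sup>2"
      using of_real_eq_iff by blast
    then show ?thesis
      using c(1)[of n] \<mu>0(1)[of 0] by (simp add: power2_eq_iff_nonneg)
  qed
  ultimately have "\<not> abs_norm_attaining T"
    using increasing_norms_not_abs_norm_attaining[of T g \<alpha>] Tp(1) c(2) c_lim by simp
  then show False
    using T(2) by simp
qed

lemma abs_norm_attaining_decomposition:
  fixes T :: "'a::complex_hilbert \<Rightarrow> 'a"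
  assumes dim: "\<not> cfinite_dim (UNIV :: 'a set)"
    and T: "positive_op T" "abs_norm_attaining T"
  obtains K F \<alpha> where "compact_op K" "positive_op K" "finite_rank_op F" "positive_op F" "\<alpha> \<ge> 0"
    "\<And>x. F x \<bullet> x \<le> \<alpha> * (x \<bullet> x)" "\<And>x. K (F x) = 0" "\<And>x. T x = K x - F x + \<alpha> *\<^sub>R x"
proof -
  note Tp = positive_opD[OF T(1)]
  obtain e :: "nat \<Rightarrow> 'a" where e: "orthonormal UNIV e" "\<And>n. T (e n) = norm (T (e n)) *\<^sub>R e n"
      and e_le: "\<And>n x. (\<And>i. i < n \<Longrightarrow> cinner x (e i) = 0) \<Longrightarrow> norm (T x) \<le> norm (T (e n)) * norm x"
    using abs_norm_attaining_eigensequence[OF T complex_vector.subspace_UNIV closed_UNIV subset_UNIV dim]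
    by (metis UNIV_I)
  define l where "l n = norm (T (e n))" for n
  have Te: "T (e n) = l n *\<^sub>R e n" for n
    using e(2) by (simp add: l_def)
  have "decseq l"
  proof (rule decseq_SucI)
    fix n
    have "norm (T (e (Suc n))) \<le> norm (T (e n)) * norm (e (Suc n))"
      using e(1) by (intro e_le) (auto simp: orthonormal_def)
    then show "l (Suc n) \<le> l n"
      using orthonormal_norm[OF e(1), of "Suc n"] by (simp add: l_def)
  qed
  moreover have "\<forall>i. 0 \<le> l i"
    by (simp add: l_def)
  ultimately obtain \<alpha> where \<alpha>: "l \<longlonglongrightarrow> \<alpha>" "\<forall>i. \<alpha> \<le> l i"
    by (rule decseq_convergent)
  have "\<alpha> \<ge> 0"
    using LIMSEQ_le_const[OF \<alpha>(1)] by (simp add: l_def)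
  define d where "d = (\<lambda>n. l n - \<alpha>)"
  have d: "decseq d" "d \<longlonglongrightarrow> 0"
    using \<open>decseq l\<close> tendsto_diff[OF \<alpha>(1) tendsto_const[of \<alpha>]] by (auto simp: d_def decseq_def)
  obtain K where K: "compact_op K" "positive_op K" "\<And>j. K (e j) = d j *\<^sub>R e j"
      "\<And>x. (\<lambda>n. \<Sum>i<n. (complex_of_real (d i) * cinner x (e i)) *\<^sub>C e i) \<longlonglongrightarrow> K x"
    using diagonal_operator[OF e(1) d] by blast
  note Kp = positive_opD[OF K(2)]
  define F where "F x = K x + \<alpha> *\<^sub>R x - T x" for x
  define P where "P n x = (\<Sum>i<n. (complex_of_real (d i) * cinner x (e i)) *\<^sub>C e i)" for n x
  have P_lim: "(\<lambda>n. P n x) \<longlonglongrightarrow> K x" for x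
    using K(4) by (simp add: P_def)
  have T_eq: "T x = K x - F x + \<alpha> *\<^sub>R x" for x
    by (simp add: F_def)
  have F_eq: "F = (\<lambda>x. K x + \<alpha> *\<^sub>R x - T x)"
    by (simp add: F_def fun_eq_iff)
  have F_bclinear: "bounded_clinear F"
    unfolding F_eq by (intro bounded_clinear_diff bounded_clinear_add bounded_clinear_scaleR
        bounded_clinear_id Kp(1) Tp(1))
  have F_lim: "(\<lambda>n. (P n x + \<alpha> *\<^sub>R x - T x) \<bullet> x) \<longlonglongrightarrow> F x \<bullet> x" for x
    unfolding F_def by (intro tendsto_intros P_lim)
  have Fe: "F (e j) = 0" for j
    by (simp add: F_def K(3) Te d_def flip: scaleR_add_left)
  \<comment> \<open>Let q be the part of x orthogonal to the first n eigenvectors. The remaining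
    part p cancels, since K truncated at n plus \<alpha> agrees with T there, and the form becomes
    \<alpha> (q \<bullet> q) - T q \<bullet> q. Maximality of e n bounds T q \<bullet> q by l n (q
    \<bullet> q), so the lower bound fails to be 0 only by d n, which tends to 0.\<close>
  have F_bounds: "- d n * (x \<bullet> x) \<le> (P n x + \<alpha> *\<^sub>R x - T x) \<bullet> x"
    "(P n x + \<alpha> *\<^sub>R x - T x) \<bullet> x \<le> \<alpha> * (x \<bullet> x)" for n x
  proof -
    define p where "p = (\<Sum>i<n. cinner x (e i) *\<^sub>C e i)"
    define q where "q = x - p"
    have on: "orthonormal {..<n} e"
      using orthonormal_subset[OF e(1)] by blast
    have x: "x = p + q"
      by (simp add: q_def)
    have q: "cinner q (e i) = 0" if "i < n" for i
      unfolding q_def p_def cinner_diff_left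
      using that by (subst cinner_sum_orthonormal[OF finite_lessThan on]) auto
    have q_orth: "q \<bullet> (\<Sum>i<n. a i *\<^sub>C e i) = 0" for a
      by (simp add: inner_eq_Re_cinner cinner_sum_right cinner_scaleC_right q)
    have Tp_sum: "T p = (\<Sum>i<n. (cinner x (e i) * complex_of_real (l i)) *\<^sub>C e i)"
      unfolding p_def by (simp add: bounded_clinearD[OF Tp(1)] Te scaleR_eq_scaleC scaleC_scaleC)
    have "P n x + \<alpha> *\<^sub>R p = (\<Sum>i<n. (complex_of_real (d i) * cinner x (e i)) *\<^sub>C e i
        + (complex_of_real \<alpha> * cinner x (e i)) *\<^sub>C e i)"
      by (simp add: P_def p_def scaleR_eq_scaleC complex_vector.scale_sum_right scaleC_scaleC sum.distrib)
    also have "\<dots> = T p"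
      unfolding Tp_sum by (intro sum.cong refl, subst scaleC_add_left[symmetric])
        (simp add: d_def ring_distribs mult.commute)
    finally have Px: "P n x = T p - \<alpha> *\<^sub>R p"
      by (simp add: algebra_simps)
    have orth: "p \<bullet> q = 0" "q \<bullet> p = 0" "q \<bullet> T p = 0" "T q \<bullet> p = 0"
      using q_orth[of "\<lambda>i. cinner x (e i)"] q_orth[of "\<lambda>i. cinner x (e i) * complex_of_real (l i)"]
        Tp(3)[of q p] by (auto simp: p_def[symmetric] Tp_sum[symmetric] inner_commute)
    have eq: "(P n x + \<alpha> *\<^sub>R x - T x) \<bullet> x = \<alpha> * (q \<bullet> q) - T q \<bullet> q"
    proof -
      have "P n x + \<alpha> *\<^sub>R x - T x = \<alpha> *\<^sub>R q - T q"
        unfolding Px by (subst (1 2) x) (simp add: bounded_clinearD[OF Tp(1)] scaleR_add_right)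
      then have "(P n x + \<alpha> *\<^sub>R x - T x) \<bullet> x = (\<alpha> *\<^sub>R q - T q) \<bullet> (p + q)"
        using x by simp
      then show ?thesis
        by (simp add: inner_diff_left inner_add_right orth)
    qed
    have xx: "x \<bullet> x = p \<bullet> p + q \<bullet> q"
      by (subst (1 2) x) (simp add: inner_add_left inner_add_right orth)
    have "T q \<bullet> q \<le> norm (T q) * norm q"
      by (rule norm_cauchy_schwarz)
    also have "\<dots> \<le> l n * norm q * norm q"
      using e_le[of n q] q by (intro mult_right_mono) (auto simp: l_def)
    also have "\<dots> = l n * (q \<bullet> q)"
      by (simp add: power2_norm_eq_inner[symmetric] power2_eq_square)
    finally have "- d n * (q \<bullet> q) \<le> \<alpha> * (q \<bullet> q) - T q \<bullet> q"
      by (simp add: d_def algebra_simps)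
    moreover have "d n * (q \<bullet> q) \<le> d n * (x \<bullet> x)"
      using decseq_ge[OF d] xx by (intro mult_left_mono) auto
    ultimately show "- d n * (x \<bullet> x) \<le> (P n x + \<alpha> *\<^sub>R x - T x) \<bullet> x"
      unfolding eq by simp
    have "\<alpha> * (q \<bullet> q) \<le> \<alpha> * (x \<bullet> x)"
      using \<open>\<alpha> \<ge> 0\<close> xx by (intro mult_left_mono) auto
    then show "(P n x + \<alpha> *\<^sub>R x - T x) \<bullet> x \<le> \<alpha> * (x \<bullet> x)"
      unfolding eq using Tp(4)[of q] by simp
  qed
  have F_le: "F x \<bullet> x \<le> \<alpha> * (x \<bullet> x)" for x
    by (rule LIMSEQ_le_const2[OF F_lim]) (use F_bounds(2) in blast)
  have "0 \<le> F x \<bullet> x" for x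
  proof (rule LIMSEQ_le[OF _ F_lim])
    show "(\<lambda>n. - d n * (x \<bullet> x)) \<longlonglongrightarrow> 0"
      using tendsto_minus[OF tendsto_mult_left_zero[OF d(2), of "x \<bullet> x"]] by simp
  qed (use F_bounds(1) in blast)
  moreover have "F x \<bullet> y = x \<bullet> F y" for x y
    by (simp add: F_def inner_add_left inner_add_right inner_diff_left inner_diff_right Kp(3) Tp(3))
  ultimately have F: "positive_op F"
    using F_bclinear by (simp add: positive_op_iff)
  \<comment> \<open>F annihilates every e i, so by symmetry F x is orthogonal to all of them and
    each partial sum of K (F x) is zero.\<close>
  have KF: "K (F x) = 0" for x
  proof (rule LIMSEQ_unique[OF P_lim])
    have "cinner (F x) (e i) = 0" for i
      by (simp add: selfadjoint_cinner[OF positive_opD(2)[OF F]] Fe)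
    then show "(\<lambda>n. P n (F x)) \<longlonglongrightarrow> 0"
      by (simp add: P_def)
  qed
  have "finite_rank_op F"
    using decomposition_finite_rank[OF T e(1) Te _ Fe K(2) F KF T_eq] \<alpha>(2) by blast
  then show ?thesis
    using that K(1,2) F \<open>\<alpha> \<ge> 0\<close> F_le KF T_eq by blast
qed

theorem theorem2p4:
  fixes T :: "'a::complex_hilbert \<Rightarrow> 'a"
  assumes "\<not> cfinite_dim (UNIV :: 'a set)"
    and "bounded_clinear T"
  shows "positive_op T \<and> abs_norm_attaining T \<longleftrightarrow>
    (\<exists>!(K, F, \<alpha>::real).
       compact_op K \<and> positive_op K \<and>
       finite_rank_op F \<and> \<alpha> \<ge> 0 \<and>
       le_op (\<lambda>x. 0) F \<and> le_op F (\<lambda>x. \<alpha> *\<^sub>R x) \<and>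
       K \<circ> F = (\<lambda>x. 0) \<and>
       T = (\<lambda>x. K x - F x + \<alpha> *\<^sub>R x))"
proof -
  define Q where "Q K F \<alpha> \<longleftrightarrow> compact_op K \<and> positive_op K \<and> finite_rank_op F \<and> \<alpha> \<ge> 0 \<and>
      le_op (\<lambda>x. 0) F \<and> le_op F (\<lambda>x. \<alpha> *\<^sub>R x) \<and> K \<circ> F = (\<lambda>x. 0) \<and>
      T = (\<lambda>x. K x - F x + \<alpha> *\<^sub>R x)" for K F and \<alpha> :: real
  have Q_iff: "Q K F \<alpha> \<longleftrightarrow> compact_op K \<and> positive_op K \<and> finite_rank_op F \<and> positive_op F \<and> \<alpha> \<ge> 0 \<and>
      (\<forall>x. F x \<bullet> x \<le> \<alpha> * (x \<bullet> x)) \<and> (\<forall>x. K (F x) = 0) \<and> (\<forall>x. T x = K x - F x + \<alpha> *\<^sub>R x)" for K F \<alpha>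
    unfolding Q_def le_op_zero_iff le_op_scaleR_iff by (auto simp: fun_eq_iff positive_opD(2))
  have "positive_op T \<and> abs_norm_attaining T \<longleftrightarrow> (\<exists>!(K, F, \<alpha>). Q K F \<alpha>)"
  proof
    assume "positive_op T \<and> abs_norm_attaining T"
    then obtain K F \<alpha> where Q: "Q K F \<alpha>"
      using abs_norm_attaining_decomposition[OF assms(1), of T] unfolding Q_iff by metis
    have unique: "K' = K \<and> F' = F \<and> \<alpha>' = \<alpha>" if Q': "Q K' F' \<alpha>'" for K' F' \<alpha>'
    proof (rule decomposition_unique[OF assms(1)])
      show "K' x - F' x + \<alpha>' *\<^sub>R x = K x - F x + \<alpha> *\<^sub>R x" for x
        using Q Q' unfolding Q_iff by metis
    qed (use Q Q' finite_rank_compact in \<open>auto simp: Q_iff\<close>)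
    show "\<exists>!(K, F, \<alpha>). Q K F \<alpha>"
    proof (rule ex1I)
      show "case (K, F, \<alpha>) of (K, F, \<alpha>) \<Rightarrow> Q K F \<alpha>"
        using Q by simp
      show "z = (K, F, \<alpha>)" if "case z of (K, F, \<alpha>) \<Rightarrow> Q K F \<alpha>" for z
        using that unique by (cases z) simp
    qed
  next
    assume "\<exists>!(K, F, \<alpha>). Q K F \<alpha>"
    then obtain K F \<alpha> where "Q K F \<alpha>"
      by auto
    then show "positive_op T \<and> abs_norm_attaining T"
      using positive_decomposition[of K F \<alpha> T] decomposition_abs_norm_attaining[of K F \<alpha> T]
      unfolding Q_iff by blast
  qed
  then show ?thesis
    unfolding Q_def .
qed

end
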